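(* Let $\mathcal{X}$ be a spike prior and let $\sigma>0$ be a constant. Suppose that $\langle x,x'\rangle$ is $(\sigma^2/n)$-subgaussian, where $x$ and $x'$ are drawn independently from $\mathcal{X}_n$. Then for any $\beta>0$ and any $\gamma>\beta^2\sigma^2$, $\mathrm{Wish}(\gamma,\beta,\mathcal{X})$ is contiguous to $\mathrm{Wish}(\gamma)$.
   Context: A spike prior is a family $\mathcal{X}=\{\mathcal{X}_n\}$, where $\mathcal{X}_n$ is a probability distribution on $\mathbb{R}^n$ such that for $x\sim\mathcal{X}_n$, $\|x\|\to1$ in probability as $n\to\infty$. A real random variable $X$ is $s^2$-subgaussian if $\mathbb{E}X=0$ and $\mathbb{E}\exp(vX)\le\exp(s^2v^2/2)$ for all $v\in\mathbb{R}$. Spiked Wishart model $\mathrm{Wish}(\gamma,\beta,\mathcal{X})$ (for $\gamma>0$, $\beta\ge0$): draw $x\sim\mathcal{X}_n$ and reveal $Y=\frac1NXX^\top$, where $X$ is an $n\times N$ matrix whose columns are sampled independently from $\mathcal{N}(0,I_n+\beta xx^\top)$, and $N=N(n)$ satisfies $n/N\to\gamma$ as $n\to\infty$. The unspiked model $\mathrm{Wish}(\gamma)$ is the case $\beta=0$ (with the same $N$). A sequence of distributions $Q_n$ is contiguous to $P_n$ if for every sequence of events $A_n$, $P_n(A_n)\to0$ implies $Q_n(A_n)\to0$. *)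

theory Defs
  imports
    "HOL-Probability.Probability"
    "Jordan_Normal_Form.Determinant"
    "Jordan_Normal_Form.Gauss_Jordan_Elimination"
begin

text \<open>
  Since the dimension $n$ tends to infinity, $\mathbb{R}^n$ is the space of the product measure
  \<open>Pi\<^sub>M {..<n} (\<lambda>_. borel)\<close>, i.e. functions on \<open>{..<n}\<close> (extended by \<open>undefined\<close>). The Euclidean
  norm is then \<open>L2_set x {..<n}\<close>.
\<close>

definition spike_prior :: "(nat \<Rightarrow> (nat \<Rightarrow> real) measure) \<Rightarrow> bool" where
  "spike_prior X \<longleftrightarrow>
     (\<forall>n. prob_space (X n) \<and> sets (X n) = sets (Pi\<^sub>M {..<n} (\<lambda>_. borel))) \<and>
     (\<forall>\<epsilon>>0. (\<lambda>n. measure (X n) {x \<in> space (X n). \<bar>L2_set x {..<n} - 1\<bar> > \<epsilon>}) \<longlonglongrightarrow> 0)"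

text \<open>
  The parameter \<open>s2\<close> stands for $s^2$. Integrability is explicit because the Bochner integral of a
  non-integrable function is 0.
\<close>

definition subgaussian :: "'a measure \<Rightarrow> real \<Rightarrow> ('a \<Rightarrow> real) \<Rightarrow> bool" where
  "subgaussian M s2 Z \<longleftrightarrow>
     integrable M Z \<and> integral\<^sup>L M Z = 0 \<and>
     (\<forall>v. integrable M (\<lambda>\<omega>. exp (v * Z \<omega>)) \<and>
          integral\<^sup>L M (\<lambda>\<omega>. exp (v * Z \<omega>)) \<le> exp (s2 * v\<^sup>2 / 2))"

definition mvn_density :: "nat \<Rightarrow> real mat \<Rightarrow> (nat \<Rightarrow> real) \<Rightarrow> real" where
  "mvn_density n S y =
     1 / sqrt ((2 * pi) ^ n * Determinant.det S) *
     exp (- (Matrix.vec n y \<bullet> (the (mat_inverse S) *\<^sub>v Matrix.vec n y)) / 2)"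

text \<open>
  The centred Gaussian $\mathcal{N}(0,S)$ on $\mathbb{R}^n$, for a symmetric positive definite
  $n\times n$ covariance matrix $S$.
\<close>

definition mvn :: "nat \<Rightarrow> real mat \<Rightarrow> (nat \<Rightarrow> real) measure" where
  "mvn n S = density (Pi\<^sub>M {..<n} (\<lambda>_. lborel)) (\<lambda>y. ennreal (mvn_density n S y))"

definition spiked_cov :: "nat \<Rightarrow> real \<Rightarrow> (nat \<Rightarrow> real) \<Rightarrow> real mat" where
  "spiked_cov n \<beta> x = 1\<^sub>m n + \<beta> \<cdot>\<^sub>m Matrix.mat n n (\<lambda>(i, j). x i * x j)"

text \<open>An $n\times N$ data matrix is given by its columns: \<open>D k i\<close> is the entry in row \<open>i\<close>, column \<open>k\<close>.\<close>

definition gaussian_columns :: "nat \<Rightarrow> nat \<Rightarrow> real mat \<Rightarrow> (nat \<Rightarrow> nat \<Rightarrow> real) measure" where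
  "gaussian_columns n N S = Pi\<^sub>M {..<N} (\<lambda>_. mvn n S)"

definition sample_covariance :: "nat \<Rightarrow> nat \<Rightarrow> (nat \<Rightarrow> nat \<Rightarrow> real) \<Rightarrow> (nat \<times> nat \<Rightarrow> real)" where
  "sample_covariance n N D =
     (\<lambda>(i, j) \<in> {..<n} \<times> {..<n}. (1 / real N) * (\<Sum>k<N. D k i * D k j))"

definition spiked_wishart ::
    "nat \<Rightarrow> nat \<Rightarrow> real \<Rightarrow> (nat \<Rightarrow> real) measure \<Rightarrow> (nat \<times> nat \<Rightarrow> real) measure" where
  "spiked_wishart n N \<beta> P =
     distr (P \<bind> (\<lambda>x. gaussian_columns n N (spiked_cov n \<beta> x)))
       (Pi\<^sub>M ({..<n} \<times> {..<n}) (\<lambda>_. borel)) (sample_covariance n N)"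

definition wishart :: "nat \<Rightarrow> nat \<Rightarrow> (nat \<times> nat \<Rightarrow> real) measure" where
  "wishart n N =
     distr (gaussian_columns n N (1\<^sub>m n))
       (Pi\<^sub>M ({..<n} \<times> {..<n}) (\<lambda>_. borel)) (sample_covariance n N)"

definition contiguous :: "(nat \<Rightarrow> 'a measure) \<Rightarrow> (nat \<Rightarrow> 'a measure) \<Rightarrow> bool" where
  "contiguous Q P \<longleftrightarrow>
     (\<forall>n. sets (Q n) = sets (P n)) \<and>
     (\<forall>A. (\<forall>n. A n \<in> sets (P n)) \<longrightarrow>
          (\<lambda>n. measure (P n) (A n)) \<longlonglongrightarrow> 0 \<longrightarrow> (\<lambda>n. measure (Q n) (A n)) \<longlonglongrightarrow> 0)"

text \<open>Consistency check: the unspiked model is the spiked model at \<open>\<beta> = 0\<close>.\<close>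

lemma mat_inverse_one: "the (mat_inverse (1\<^sub>m n :: real mat)) = 1\<^sub>m n"
proof (cases "mat_inverse (1\<^sub>m n :: real mat)")
  case None
  have "1\<^sub>m n \<in> Units (ring_mat TYPE(real) n ())"
    by (auto simp: Units_def ring_mat_def)
  moreover have "1\<^sub>m n \<notin> Units (ring_mat TYPE(real) n ())"
    by (rule mat_inverse(1)[OF one_carrier_mat None])
  ultimately show ?thesis by contradiction
next
  case (Some B)
  with mat_inverse(2)[OF one_carrier_mat Some] show ?thesis by auto
qed

lemma mvn_density_one:
  "mvn_density n (1\<^sub>m n) y = (\<Prod>i<n. std_normal_density (y i))"
proof -
  have "(\<Sum>i<n. (y i)\<^sup>2 / 2) = (\<Sum>i<n. y i * y i) / 2"
    by (simp add: sum_divide_distrib power2_eq_square)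
  then have e: "exp (- ((\<Sum>i<n. y i * y i) / 2)) = (\<Prod>i<n. exp (- ((y i)\<^sup>2 / 2)))"
    by (simp add: exp_sum[symmetric] sum_negf)
  have s: "sqrt (2 ^ n * pi ^ n) = sqrt (2 * pi) ^ n"
    by (simp only: power_mult_distrib[symmetric] real_sqrt_power)
  show ?thesis
    by (simp add: mvn_density_def mat_inverse_one scalar_prod_def atLeast0LessThan
        normal_density_def prod_dividef e s)
qed

lemma prob_space_mvn_one: "prob_space (mvn n (1\<^sub>m n))"
proof (rule prob_spaceI)
  interpret product_sigma_finite "\<lambda>_::nat. lborel :: real measure" ..
  have m: "(\<lambda>y. ennreal (mvn_density n (1\<^sub>m n) y)) \<in> borel_measurable (Pi\<^sub>M {..<n} (\<lambda>_. lborel))"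
    unfolding mvn_density_one by measurable
  have "(\<integral>\<^sup>+y. (\<Prod>i<n. ennreal (std_normal_density (y i))) \<partial>Pi\<^sub>M {..<n} (\<lambda>_. lborel))
      = (\<Prod>i<n. \<integral>\<^sup>+y. ennreal (std_normal_density y) \<partial>lborel)"
    by (rule product_nn_integral_prod) auto
  also have "\<dots> = 1"
    using prob_space.emeasure_space_1[OF prob_space_normal_density[of 1 0]]
    by (simp add: emeasure_density)
  finally show "emeasure (mvn n (1\<^sub>m n)) (space (mvn n (1\<^sub>m n))) = 1"
    unfolding mvn_def using m
    by (simp add: emeasure_density nn_integral_set_ennreal[symmetric] mvn_density_one prod_ennreal
        cong: nn_integral_cong)
qed

lemma spiked_wishart_0:
  assumes "prob_space P"
  shows "spiked_wishart n N 0 P = wishart n N"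
proof -
  have "0 \<cdot>\<^sub>m M = 0\<^sub>m n n" if "M \<in> carrier_mat n n" for M :: "real mat"
    using that by (intro eq_matI) auto
  then have "spiked_cov n 0 x = 1\<^sub>m n" for x
    by (simp add: spiked_cov_def)
  moreover have "subprob_space (gaussian_columns n N (1\<^sub>m n))"
    unfolding gaussian_columns_def
    by (intro prob_space_imp_subprob_space prob_space_PiM prob_space_mvn_one)
  ultimately show ?thesis
    by (simp add: spiked_wishart_def wishart_def bind_const'[OF assms])
qed

end

theory Submission
  imports Defs
begin

text \<open>
  It suffices to compare the data matrices. Conditionally on the spike \<open>x\<close>, the likelihood ratio
  \<open>L\<^sub>x\<close> of the columns depends only on the total energy \<open>U\<^sub>x = \<Sum>\<^sub>k \<langle>x, y\<^sub>k\<rangle>\<^sup>2\<close>. The plain second moment of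
  the averaged likelihood ratio may be infinite, because of pairs with \<open>\<beta> |\<langle>x, x'\<rangle>| \<ge> 1\<close>, so \<open>L\<^sub>x\<close> is truncated to the event that
  \<open>U\<^sub>x\<close> is at most \<open>1 + \<delta>\<close> times its mean under the spiked law; a Chernoff bound, uniform in \<open>x\<close>, shows that
  this event has spiked probability tending to 1. On it, part of the exponent of \<open>L\<^sub>x\<close> may be traded
  for a constant. With the right tilt the Gaussian integral is explicit and shows that
  the truncated ratios of \<open>x\<close> and \<open>x'\<close> have mean product at most
  \<open>exp (N (1 + \<delta>) \<beta>\<^sup>2 \<langle>x, x'\<rangle>\<^sup>2 / 2)\<close>, whatever the norms of \<open>x\<close> and \<open>x'\<close>.
  As \<open>N / n \<longlonglongrightarrow> 1 / \<gamma>\<close> and \<open>\<beta>\<^sup>2 \<sigma>\<^sup>2 < \<gamma>\<close>, the subgaussian hypothesis bounds the average of the right-hand side,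
  and Cauchy--Schwarz finishes the proof.
\<close>

subsection \<open>Gaussian integrals\<close>

abbreviation std_normal :: "real measure" where
  "std_normal \<equiv> density lborel (\<lambda>x. ennreal (std_normal_density x))"

lemma prob_space_std_normal: "prob_space std_normal"
  by (rule prob_space_normal_density) simp

interpretation std_normal: prob_space std_normal
  by (rule prob_space_std_normal)

interpretation std_normals: product_sigma_finite "\<lambda>_::nat. std_normal"
  by standard

text \<open>Completing the square: the weighted density is a constant times the normal density with
  mean \<open>c / (1 - b)\<close> and variance \<open>1 / (1 - b)\<close>, whose total mass is
  1.\<close>

lemma nn_integral_exp_quadratic_std_normal:
  fixes b c :: real
  assumes "b < 1"
  shows "(\<integral>\<^sup>+g. ennreal (exp (b / 2 * g\<^sup>2 + c * g)) \<partial>std_normal)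
       = ennreal (exp (c\<^sup>2 / (2 * (1 - b))) / sqrt (1 - b))"
proof -
  define s where "s = 1 / sqrt (1 - b)"
  have s: "s > 0" "s\<^sup>2 = 1 / (1 - b)" using assms by (auto simp: s_def power_divide)
  have sq: "- (g\<^sup>2 / 2) + (b / 2 * g\<^sup>2 + c * g)
      = c\<^sup>2 / (2 * (1 - b)) - (g - c / (1 - b))\<^sup>2 / (2 * s\<^sup>2)" for g
  proof -
    have "- (g\<^sup>2 / 2) + ((1 - d) / 2 * g\<^sup>2 + c * g)
        = c\<^sup>2 / (2 * d) - (g - c / d)\<^sup>2 / (2 * (1 / d))" if "d > 0" for d
      using that by (simp add: field_simps power2_eq_square)
    from this[of "1 - b"] show ?thesis using assms unfolding s by simp
  qed
  have "std_normal_density g * exp (b / 2 * g\<^sup>2 + c * g)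
      = exp (c\<^sup>2 / (2 * (1 - b))) / sqrt (1 - b) * normal_density (c / (1 - b)) s g" for g
  proof -
    have "exp (- (g\<^sup>2 / 2)) * exp (b / 2 * g\<^sup>2 + c * g)
        = exp (c\<^sup>2 / (2 * (1 - b))) * exp (- ((g - c / (1 - b))\<^sup>2 / (2 * s\<^sup>2)))"
      unfolding exp_add[symmetric] sq by simp
    moreover have "sqrt (2 * pi * s\<^sup>2) = sqrt (2 * pi) * s"
      using s(1) by (simp add: real_sqrt_mult)
    ultimately show ?thesis
      using assms by (simp add: normal_density_def s_def)
  qed
  then have "(\<integral>\<^sup>+g. ennreal (exp (b / 2 * g\<^sup>2 + c * g)) \<partial>std_normal)
      = (\<integral>\<^sup>+g. ennreal (exp (c\<^sup>2 / (2 * (1 - b))) / sqrt (1 - b)) * ennreal (normal_density (c / (1 - b)) s g) \<partial>lborel)"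
    using assms by (simp add: nn_integral_density ennreal_mult[symmetric])
  also have "\<dots> = ennreal (exp (c\<^sup>2 / (2 * (1 - b))) / sqrt (1 - b))"
    using prob_space.emeasure_space_1[OF prob_space_normal_density[OF s(1), of "c / (1 - b)"]]
    by (simp add: nn_integral_cmult emeasure_density)
  finally show ?thesis .
qed

lemma nn_integral_exp_linear_std_normal:
  "(\<integral>\<^sup>+g. ennreal (exp (c * g)) \<partial>std_normal) = ennreal (exp (c\<^sup>2 / 2))"
  using nn_integral_exp_quadratic_std_normal[of 0 c] by simp

text \<open>A finite product of sigma-finite measures is determined by its values on boxes. There
  the indicator factorises over the coordinates (\<open>ind\<close>), so the integral of the product
  density splits into one-dimensional integrals.\<close>

lemma PiM_density:
  fixes f :: "'i \<Rightarrow> 'a \<Rightarrow> ennreal"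
  assumes "finite I"
    and "\<And>i. sigma_finite_measure (M i)"
    and "\<And>i. sigma_finite_measure (density (M i) (f i))"
    and [measurable]: "\<And>i. f i \<in> borel_measurable (M i)"
  shows "Pi\<^sub>M I (\<lambda>i. density (M i) (f i)) = density (Pi\<^sub>M I M) (\<lambda>x. \<Prod>i\<in>I. f i (x i))"
proof -
  interpret M: product_sigma_finite M using assms(2) by (simp add: product_sigma_finite_def)
  interpret D: product_sigma_finite "\<lambda>i. density (M i) (f i)" using assms(3) by (simp add: product_sigma_finite_def)
  have meas[measurable]: "(\<lambda>x. \<Prod>i\<in>I. f i (x i)) \<in> borel_measurable (Pi\<^sub>M I M)" by measurable
  have "density (Pi\<^sub>M I M) (\<lambda>x. \<Prod>i\<in>I. f i (x i)) = Pi\<^sub>M I (\<lambda>i. density (M i) (f i))"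
  proof (rule D.PiM_eqI[OF assms(1)])
    show "sets (density (Pi\<^sub>M I M) (\<lambda>x. \<Prod>i\<in>I. f i (x i))) = sets (Pi\<^sub>M I (\<lambda>i. density (M i) (f i)))"
      by (simp cong: sets_PiM_cong)
  next
    fix A assume "\<And>i. i \<in> I \<Longrightarrow> A i \<in> sets (density (M i) (f i))"
    then have A[measurable]: "A i \<in> sets (M i)" if "i \<in> I" for i using that by simp
    have ind: "indicator (Pi\<^sub>E I A) x = (\<Prod>i\<in>I. indicator (A i) (x i) :: ennreal)"
      if "x \<in> space (Pi\<^sub>M I M)" for x
    proof (cases "\<forall>i\<in>I. x i \<in> A i")
      case True
      then have "x \<in> Pi\<^sub>E I A" using that by (auto simp: space_PiM PiE_def)
      then show ?thesis using True by simp
    next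
      case False
      then have "x \<notin> Pi\<^sub>E I A" "(\<Prod>i\<in>I. indicator (A i) (x i) :: ennreal) = 0"
        using assms(1) False by (auto simp: PiE_def Pi_def indicator_def intro!: prod_zero)
      then show ?thesis by simp
    qed
    have "emeasure (density (Pi\<^sub>M I M) (\<lambda>x. \<Prod>i\<in>I. f i (x i))) (Pi\<^sub>E I A)
        = (\<integral>\<^sup>+x. (\<Prod>i\<in>I. f i (x i)) * indicator (Pi\<^sub>E I A) x \<partial>Pi\<^sub>M I M)"
      using assms(1) A by (intro emeasure_density) (auto intro: sets_PiM_I_finite)
    also have "\<dots> = (\<integral>\<^sup>+x. (\<Prod>i\<in>I. f i (x i) * indicator (A i) (x i)) \<partial>Pi\<^sub>M I M)"
      by (intro nn_integral_cong) (simp add: ind prod.distrib)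
    also have "\<dots> = (\<Prod>i\<in>I. \<integral>\<^sup>+x. f i x * indicator (A i) x \<partial>M i)"
      using assms(1) by (intro M.product_nn_integral_prod) auto
    also have "\<dots> = (\<Prod>i\<in>I. emeasure (density (M i) (f i)) (A i))"
      using A by (intro prod.cong refl emeasure_density[symmetric]) auto
    finally show "emeasure (density (Pi\<^sub>M I M) (\<lambda>x. \<Prod>i\<in>I. f i (x i))) (Pi\<^sub>E I A)
        = (\<Prod>i\<in>I. emeasure (density (M i) (f i)) (A i))" .
  qed
  then show ?thesis by simp
qed

lemma mvn_one: "mvn n (1\<^sub>m n) = Pi\<^sub>M {..<n} (\<lambda>_. std_normal)"
proof -
  have "Pi\<^sub>M {..<n} (\<lambda>_. std_normal)
      = density (Pi\<^sub>M {..<n} (\<lambda>_. lborel)) (\<lambda>x. \<Prod>i<n. ennreal (std_normal_density (x i)))"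
    by (rule PiM_density) (auto intro: lborel.sigma_finite_measure_axioms std_normal.sigma_finite_measure_axioms)
  then show ?thesis
    by (simp add: mvn_def mvn_density_one prod_ennreal)
qed

definition dot :: "nat \<Rightarrow> (nat \<Rightarrow> real) \<Rightarrow> (nat \<Rightarrow> real) \<Rightarrow> real" where
  "dot n x y = (\<Sum>i<n. x i * y i)"

lemma dot_self_nonneg: "0 \<le> dot n x x"
  by (auto simp: dot_def intro: sum_nonneg)

lemma nn_integral_exp_dot_mvn_one:
  "(\<integral>\<^sup>+y. ennreal (exp (dot n c y)) \<partial>mvn n (1\<^sub>m n)) = ennreal (exp (dot n c c / 2))"
proof -
  have "(\<integral>\<^sup>+y. ennreal (exp (dot n c y)) \<partial>mvn n (1\<^sub>m n))
      = (\<integral>\<^sup>+y. (\<Prod>i<n. ennreal (exp (c i * y i))) \<partial>Pi\<^sub>M {..<n} (\<lambda>_. std_normal))"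
    by (simp add: mvn_one dot_def exp_sum prod_ennreal)
  also have "\<dots> = (\<Prod>i<n. \<integral>\<^sup>+g. ennreal (exp (c i * g)) \<partial>std_normal)"
    by (rule std_normals.product_nn_integral_prod) auto
  also have "\<dots> = ennreal (exp (dot n c c / 2))"
    by (simp add: nn_integral_exp_linear_std_normal prod_ennreal dot_def exp_sum[symmetric] sum_divide_distrib power2_eq_square)
  finally show ?thesis .
qed

lemma dot_measurable [measurable]:
  assumes [measurable]: "f \<in> measurable M (Pi\<^sub>M {..<n} (\<lambda>_. borel))" "g \<in> measurable M (Pi\<^sub>M {..<n} (\<lambda>_. borel))"
  shows "(\<lambda>w. dot n (f w) (g w)) \<in> borel_measurable M"
  unfolding dot_def by measurable

lemma sets_mvn [measurable_cong]: "sets (mvn n S) = sets (Pi\<^sub>M {..<n} (\<lambda>_. borel))"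
  by (simp add: mvn_def cong: sets_PiM_cong)

text \<open>\<open>d\<close> is the determinant of I - p x x^T - q x' x'^T, reduced to a 2 by 2
  determinant in the inner products of \<open>x\<close> and \<open>x'\<close>. The conditions
  \<open>p * dot n x x < 1\<close> and \<open>0 < d\<close> make this matrix positive definite, so
  that the integral is finite.\<close>

lemma nn_integral_exp_two_squares_mvn_one:
  fixes n :: nat and x x' :: "nat \<Rightarrow> real" and p q :: real
  defines "d \<equiv> (1 - p * dot n x x) * (1 - q * dot n x' x') - p * q * (dot n x x')\<^sup>2"
  assumes x[measurable]: "x \<in> space (Pi\<^sub>M {..<n} (\<lambda>_. borel))" 
    and x'[measurable]: "x' \<in> space (Pi\<^sub>M {..<n} (\<lambda>_. borel))"
    and p: "0 \<le> p" "p * dot n x x < 1" and q: "0 \<le> q" and d: "0 < d"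
  shows "(\<integral>\<^sup>+y. ennreal (exp (p / 2 * (dot n x y)\<^sup>2 + q / 2 * (dot n x' y)\<^sup>2)) \<partial>mvn n (1\<^sub>m n))
       = ennreal (1 / sqrt d)"
proof -
  \<comment> \<open>Hubbard--Stratonovich: each squared linear form becomes a Gaussian average \<open>hs\<close> of exponentials
    of linear forms, so that the integral over \<open>y\<close> factorises.\<close>
  define a b t where "a = dot n x x" and "b = dot n x' x'" and "t = dot n x x'"
  note abt = a_def[symmetric] b_def[symmetric] t_def[symmetric]
  define c where "c g h = (\<lambda>i. sqrt p * g * x i + sqrt q * h * x' i)" for g h
  interpret mvn: prob_space "mvn n (1\<^sub>m n)" by (rule prob_space_mvn_one)
  interpret pair: pair_sigma_finite std_normal "mvn n (1\<^sub>m n)" by standard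
  have dot_c: "dot n (c g h) y = sqrt p * dot n x y * g + sqrt q * dot n x' y * h" for g h y
    by (simp add: dot_def c_def algebra_simps sum.distrib sum_distrib_left)
  have "dot n (\<lambda>i. r * g * x i + s * h * x' i) (\<lambda>i. r * g * x i + s * h * x' i)
      = r\<^sup>2 * g\<^sup>2 * a + s\<^sup>2 * h\<^sup>2 * b + 2 * (r * s * t * g) * h" for g h r s
    by (simp add: dot_def a_def b_def t_def algebra_simps power2_eq_square sum.distrib sum_distrib_left)
  from this[of "sqrt p" _ "sqrt q"]
  have "dot n (c g h) (c g h) = (sqrt p)\<^sup>2 * g\<^sup>2 * a + (sqrt q)\<^sup>2 * h\<^sup>2 * b + 2 * (sqrt p * sqrt q * t * g) * h" for g h
    by (simp add: c_def)
  then have dot_cc: "dot n (c g h) (c g h) / 2 = p * a / 2 * g\<^sup>2 + (q * b / 2 * h\<^sup>2 + (sqrt p * sqrt q * t * g) * h)" for g h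
    using p q by simp
  \<comment> \<open>The term \<open>p * q * t\<^sup>2\<close> is nonnegative, so
    \<open>0 < d\<close> makes this product positive; its first factor is positive by assumption,
    hence so is the second.\<close>
  have "(1 - p * a) * (1 - q * b) > 0"
    using d p q unfolding d_def abt by (smt (verit) mult_nonneg_nonneg zero_le_power2)
  then have qb: "q * b < 1" using p by (simp add: abt zero_less_mult_iff)
  have d': "1 - (p * a + p * q * t\<^sup>2 / (1 - q * b)) = d / (1 - q * b)"
    using qb by (simp add: d_def abt field_simps)
  have B: "p * a + p * q * t\<^sup>2 / (1 - q * b) < 1"
    using d qb d' by (smt (verit) divide_pos_pos)
  have hs: "ennreal (exp (p / 2 * (dot n x y)\<^sup>2 + q / 2 * (dot n x' y)\<^sup>2))
      = (\<integral>\<^sup>+g. \<integral>\<^sup>+h. ennreal (exp (dot n (c g h) y)) \<partial>std_normal \<partial>std_normal)" for y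
  proof -
    have "(\<integral>\<^sup>+g. \<integral>\<^sup>+h. ennreal (exp (dot n (c g h) y)) \<partial>std_normal \<partial>std_normal)
        = (\<integral>\<^sup>+g. \<integral>\<^sup>+h. ennreal (exp (sqrt p * dot n x y * g)) * ennreal (exp (sqrt q * dot n x' y * h)) \<partial>std_normal \<partial>std_normal)"
      unfolding dot_c by (simp add: exp_add ennreal_mult)
    also have "\<dots> = ennreal (exp ((sqrt p * dot n x y)\<^sup>2 / 2)) * ennreal (exp ((sqrt q * dot n x' y)\<^sup>2 / 2))"
      by (subst nn_integral_cmult, simp, subst nn_integral_multc, simp, simp only: nn_integral_exp_linear_std_normal)
    finally show ?thesis
      using p q by (simp add: ennreal_mult[symmetric] exp_add[symmetric] power_mult_distrib)
  qed
  have [measurable]: "(\<lambda>(h, y). ennreal (exp (dot n (c g h) y))) \<in> borel_measurable (std_normal \<Otimes>\<^sub>M mvn n (1\<^sub>m n))" for g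
    unfolding dot_c by measurable
  have [measurable]: "(\<lambda>(g, y). \<integral>\<^sup>+h. ennreal (exp (dot n (c g h) y)) \<partial>std_normal) \<in> borel_measurable (std_normal \<Otimes>\<^sub>M mvn n (1\<^sub>m n))"
    unfolding dot_c by measurable
  have "(\<integral>\<^sup>+y. ennreal (exp (p / 2 * (dot n x y)\<^sup>2 + q / 2 * (dot n x' y)\<^sup>2)) \<partial>mvn n (1\<^sub>m n))
      = (\<integral>\<^sup>+y. \<integral>\<^sup>+g. \<integral>\<^sup>+h. ennreal (exp (dot n (c g h) y)) \<partial>std_normal \<partial>std_normal \<partial>mvn n (1\<^sub>m n))"
    by (simp only: hs)
  also have "\<dots> = (\<integral>\<^sup>+g. \<integral>\<^sup>+y. \<integral>\<^sup>+h. ennreal (exp (dot n (c g h) y)) \<partial>std_normal \<partial>mvn n (1\<^sub>m n) \<partial>std_normal)"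
    by (rule pair.Fubini') measurable
  also have "\<dots> = (\<integral>\<^sup>+g. \<integral>\<^sup>+h. \<integral>\<^sup>+y. ennreal (exp (dot n (c g h) y)) \<partial>mvn n (1\<^sub>m n) \<partial>std_normal \<partial>std_normal)"
    by (intro nn_integral_cong pair.Fubini') measurable
  also have "\<dots> = (\<integral>\<^sup>+g. \<integral>\<^sup>+h. ennreal (exp (p * a / 2 * g\<^sup>2)) * ennreal (exp (q * b / 2 * h\<^sup>2 + (sqrt p * sqrt q * t * g) * h)) \<partial>std_normal \<partial>std_normal)"
    unfolding nn_integral_exp_dot_mvn_one dot_cc exp_add[of "p * a / 2 * _"] by (simp add: ennreal_mult)
  \<comment> \<open>The integral over \<open>h\<close> has a linear coefficient proportional to
    \<open>g\<close>. Completing the square adds \<open>p * q * t\<^sup>2 / (1 - q * b)\<close> to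
    the coefficient of \<open>g\<^sup>2 / 2\<close>; by \<open>d'\<close> the outer integral over
    \<open>g\<close> then contributes the factor \<open>d / (1 - q * b)\<close> under the
    root.\<close>
  also have "\<dots> = (\<integral>\<^sup>+g. ennreal (exp (p * a / 2 * g\<^sup>2)) * ennreal (exp ((sqrt p * sqrt q * t * g)\<^sup>2 / (2 * (1 - q * b))) / sqrt (1 - q * b)) \<partial>std_normal)"
    by (subst nn_integral_cmult, simp, subst nn_integral_exp_quadratic_std_normal[OF qb], rule refl)
  also have "\<dots> = (\<integral>\<^sup>+g. ennreal (1 / sqrt (1 - q * b)) * ennreal (exp ((p * a + p * q * t\<^sup>2 / (1 - q * b)) / 2 * g\<^sup>2 + 0 * g)) \<partial>std_normal)"
  proof (intro nn_integral_cong)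
    fix g
    have "exp (p * a / 2 * g\<^sup>2) * exp ((sqrt p * sqrt q * t * g)\<^sup>2 / (2 * (1 - q * b)))
        = exp ((p * a + p * q * t\<^sup>2 / (1 - q * b)) / 2 * g\<^sup>2)"
      unfolding exp_add[symmetric] using p q qb
      by (simp add: power_mult_distrib field_simps)
    then show "ennreal (exp (p * a / 2 * g\<^sup>2)) * ennreal (exp ((sqrt p * sqrt q * t * g)\<^sup>2 / (2 * (1 - q * b))) / sqrt (1 - q * b))
       = ennreal (1 / sqrt (1 - q * b)) * ennreal (exp ((p * a + p * q * t\<^sup>2 / (1 - q * b)) / 2 * g\<^sup>2 + 0 * g))"
      using qb by (simp add: ennreal_mult[symmetric] del: ennreal_plus)
  qed
  also have "\<dots> = ennreal (1 / sqrt (1 - q * b)) * ennreal (1 / sqrt (d / (1 - q * b)))"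
    by (subst nn_integral_cmult, simp, subst nn_integral_exp_quadratic_std_normal[OF B]) (simp add: d')
  also have "\<dots> = ennreal (1 / sqrt d)"
    using qb d by (simp add: ennreal_mult[symmetric] real_sqrt_divide)
  finally show ?thesis .
qed

subsection \<open>Rank-one spiked covariance matrices\<close>

text \<open>Sylvester's determinant identity. Multiplying the block matrix \<open>?K\<close> by the
  block unitriangular \<open>?A\<close> or \<open>?B\<close>, both of determinant 1, clears one
  off-diagonal block and leaves one side of the identity or the other.\<close>

lemma det_one_plus_mult:
  fixes u v :: "'a :: idom mat"
  assumes u: "u \<in> carrier_mat n m" and v: "v \<in> carrier_mat m n"
  shows "Determinant.det (1\<^sub>m n + u * v) = Determinant.det (1\<^sub>m m + v * u)"
proof -
  let ?K = "four_block_mat (1\<^sub>m n) (- u) v (1\<^sub>m m)"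
  let ?A = "four_block_mat (1\<^sub>m n) u (0\<^sub>m m n) (1\<^sub>m m)"
  let ?B = "four_block_mat (1\<^sub>m n) (0\<^sub>m n m) (- v) (1\<^sub>m m)"
  have car: "?K \<in> carrier_mat (n + m) (n + m)" "?A \<in> carrier_mat (n + m) (n + m)"
    "?B \<in> carrier_mat (n + m) (n + m)" by auto
  have dA: "Determinant.det ?A = 1" "Determinant.det ?B = 1"
    using u v by (simp_all add: det_four_block_mat_lower_left_zero[of _ n _ m] det_four_block_mat_upper_right_zero[of _ n _ m])
  have "?K * ?A = four_block_mat (1\<^sub>m n) (0\<^sub>m n m) v (1\<^sub>m m + v * u)"
    using u v by (subst mult_four_block_mat[of _ n n _ m _ m _ _ n _ m])
      (auto simp: comm_add_mat[of _ m m])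
  then have "Determinant.det ?K = Determinant.det (1\<^sub>m m + v * u)"
    using u v det_mult[OF car(1,2)] dA
    by (simp add: det_four_block_mat_upper_right_zero[of _ n _ m])
  moreover have "?K * ?B = four_block_mat (1\<^sub>m n + u * v) (- u) (0\<^sub>m m n) (1\<^sub>m m)"
    using u v by (subst mult_four_block_mat[of _ n n _ m _ m _ _ n _ m]) auto
  then have "Determinant.det ?K = Determinant.det (1\<^sub>m n + u * v)"
    using u v det_mult[OF car(1,3)] dA
    by (simp add: det_four_block_mat_lower_left_zero[of _ n _ m])
  ultimately show ?thesis by simp
qed

text \<open>The perturbation has rank one, so Sylvester's identity with inner dimension 1 reduces
  the determinant to a scalar.\<close>

lemma det_spiked_cov: "Determinant.det (spiked_cov n \<beta> x) = 1 + \<beta> * dot n x x"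
proof -
  let ?u = "Matrix.mat n 1 (\<lambda>(i, j). \<beta> * x i)" and ?v = "Matrix.mat 1 n (\<lambda>(i, j). x j)"
  have "spiked_cov n \<beta> x = 1\<^sub>m n + ?u * ?v"
    unfolding spiked_cov_def by (intro eq_matI) (auto simp: scalar_prod_def)
  then have "Determinant.det (spiked_cov n \<beta> x) = Determinant.det (1\<^sub>m 1 + ?v * ?u)"
    using det_one_plus_mult[of ?u n 1 ?v] by simp
  also have "\<dots> = 1 + \<beta> * dot n x x"
    by (subst det_single) (auto simp: scalar_prod_def dot_def sum_distrib_left atLeast0LessThan mult_ac intro!: sum.cong)
  finally show ?thesis .
qed

text \<open>\<open>mat_inverse\<close> returns an option: a one-sided inverse of a square matrix is
  two-sided, which excludes \<open>None\<close>, and uniqueness of inverses identifies the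
  result.\<close>

lemma the_mat_inverseI:
  fixes A B :: "'a :: field mat"
  assumes A: "A \<in> carrier_mat n n" and B: "B \<in> carrier_mat n n" and AB: "A * B = 1\<^sub>m n"
  shows "the (mat_inverse A) = B"
proof -
  have BA: "B * A = 1\<^sub>m n" by (rule mat_mult_left_right_inverse[OF A B AB])
  have "A \<in> Units (ring_mat TYPE('a) n ())"
    using A B AB BA by (auto simp: Units_def ring_mat_def)
  then obtain C where C: "mat_inverse A = Some C"
    using mat_inverse(1)[OF A, where b = "()"] by (cases "mat_inverse A") auto
  have "C = (B * A) * C" using mat_inverse(2)[OF A C] BA by auto
  also have "\<dots> = B" using mat_inverse(2)[OF A C] A B by (simp add: assoc_mult_mat[of _ n n _ n _ n])
  finally show ?thesis using C by simp
qed

text \<open>Since (x x^T)^2 is \<open>dot n x x\<close> times x x^T, the matrices of this shape with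
  a common \<open>x\<close> are closed under multiplication. Inverting one of them then means
  solving a scalar equation for the coefficient.\<close>

lemma spiked_cov_mult:
  "spiked_cov n b x * spiked_cov n c x = spiked_cov n (b + c + b * c * dot n x x) x"
proof (rule eq_matI)
  have car: "spiked_cov n b x \<in> carrier_mat n n" for b
    by (auto simp: spiked_cov_def)
  show "dim_row (spiked_cov n b x * spiked_cov n c x) = dim_row (spiked_cov n (b + c + b * c * dot n x x) x)"
    "dim_col (spiked_cov n b x * spiked_cov n c x) = dim_col (spiked_cov n (b + c + b * c * dot n x x) x)"
    by (simp_all add: spiked_cov_def)
  fix i j
  assume "i < dim_row (spiked_cov n (b + c + b * c * dot n x x) x)"
    "j < dim_col (spiked_cov n (b + c + b * c * dot n x x) x)"
  then have ij: "i < n" "j < n" by (simp_all add: spiked_cov_def)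
  have cov: "spiked_cov n b x $$ (k, l) = (if k = l then 1 else 0) + b * (x k * x l)"
    if "k < n" "l < n" for k l b
    using that by (simp add: spiked_cov_def)
  have "(spiked_cov n b x * spiked_cov n c x) $$ (i, j)
      = (\<Sum>k<n. spiked_cov n b x $$ (i, k) * spiked_cov n c x $$ (k, j))"
    using car[of b] car[of c] ij by (simp add: scalar_prod_def atLeast0LessThan)
  \<comment> \<open>The two identity parts become Kronecker deltas in the summation index, so that
    each sum over \<open>k\<close> collapses to a single term.\<close>
  also have "\<dots> = (\<Sum>k<n. (if k = i then (if i = j then 1 else 0) + c * (x i * x j) else 0)
      + (if k = j then b * (x i * x j) else 0) + b * c * (x i * x j) * (x k * x k))"
    using ij by (intro sum.cong refl) (auto simp: cov algebra_simps)
  also have "\<dots> = (if i = j then 1 else 0) + c * (x i * x j) + b * (x i * x j) + b * c * (x i * x j) * dot n x x"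
    using ij by (simp add: sum.distrib dot_def sum_distrib_left)
  also have "\<dots> = spiked_cov n (b + c + b * c * dot n x x) x $$ (i, j)"
    using ij by (simp add: cov algebra_simps)
  finally show "(spiked_cov n b x * spiked_cov n c x) $$ (i, j)
      = spiked_cov n (b + c + b * c * dot n x x) x $$ (i, j)" .
qed

text \<open>The Sherman-Morrison formula: the second coefficient is chosen to make the combined
  coefficient in \<open>spiked_cov_mult\<close> vanish.\<close>

lemma mat_inverse_spiked_cov:
  assumes "1 + \<beta> * dot n x x \<noteq> 0"
  shows "the (mat_inverse (spiked_cov n \<beta> x)) = spiked_cov n (- \<beta> / (1 + \<beta> * dot n x x)) x"
proof (rule the_mat_inverseI)
  let ?s = "- \<beta> / (1 + \<beta> * dot n x x)"
  have "\<beta> + s + \<beta> * s * dot n x x = \<beta> + s * (1 + \<beta> * dot n x x)" for s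
    by (simp add: algebra_simps)
  from this[of ?s] have "\<beta> + ?s + \<beta> * ?s * dot n x x = 0"
    using assms by simp
  moreover have "spiked_cov n 0 x = 1\<^sub>m n"
    by (intro eq_matI) (auto simp: spiked_cov_def)
  ultimately show "spiked_cov n \<beta> x * spiked_cov n ?s x = 1\<^sub>m n"
    by (simp only: spiked_cov_mult)
qed (auto simp: spiked_cov_def)

lemma quadratic_form_spiked_cov:
  "Matrix.vec n y \<bullet> (spiked_cov n b x *\<^sub>v Matrix.vec n y) = dot n y y + b * (dot n x y)\<^sup>2"
proof -
  have "(spiked_cov n b x *\<^sub>v Matrix.vec n y) $ i = y i + b * x i * dot n x y" if "i < n" for i
  proof -
    have "(spiked_cov n b x *\<^sub>v Matrix.vec n y) $ i = (\<Sum>j<n. (if j = i then y i else 0) + b * x i * (x j * y j))"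
      using that by (auto simp: spiked_cov_def scalar_prod_def atLeast0LessThan algebra_simps intro!: sum.cong)
    also have "\<dots> = y i + b * x i * dot n x y"
      using that by (simp add: sum.distrib dot_def sum_distrib_left)
    finally show ?thesis .
  qed
  moreover have "dim_vec (spiked_cov n b x *\<^sub>v Matrix.vec n y) = n" by (simp add: spiked_cov_def)
  ultimately have "Matrix.vec n y \<bullet> (spiked_cov n b x *\<^sub>v Matrix.vec n y) = (\<Sum>i<n. y i * (y i + b * x i * dot n x y))"
    by (simp add: scalar_prod_def atLeast0LessThan)
  also have "\<dots> = dot n y y + b * dot n x y * (\<Sum>i<n. x i * y i)"
    by (simp add: dot_def algebra_simps sum.distrib sum_distrib_left)
  finally show ?thesis by (simp add: dot_def power2_eq_square)
qed

text \<open>The density of one spiked column with respect to a standard Gaussian one, as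
  \<open>mvn_spiked_cov\<close> confirms. The term \<open>dot n y y\<close> has cancelled, so
  \<open>y\<close> enters only through its projection on the spike.\<close>

definition column_lr :: "nat \<Rightarrow> real \<Rightarrow> (nat \<Rightarrow> real) \<Rightarrow> (nat \<Rightarrow> real) \<Rightarrow> real" where
  "column_lr n \<beta> x y =
     exp (\<beta> / (1 + \<beta> * dot n x x) / 2 * (dot n x y)\<^sup>2) / sqrt (1 + \<beta> * dot n x x)"

lemma column_lr_nonneg: "0 \<le> \<beta> \<Longrightarrow> 0 \<le> column_lr n \<beta> x y"
  by (simp add: column_lr_def dot_self_nonneg)

lemma mvn_density_spiked_cov:
  assumes "0 \<le> \<beta>"
  shows "mvn_density n (spiked_cov n \<beta> x) y = mvn_density n (1\<^sub>m n) y * column_lr n \<beta> x y"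
proof -
  have "0 < 1 + \<beta> * dot n x x"
    using assms dot_self_nonneg[of n x] by (simp add: add_pos_nonneg)
  moreover have "Matrix.vec n y \<bullet> (1\<^sub>m n *\<^sub>v Matrix.vec n y) = dot n y y"
    by (simp add: scalar_prod_def dot_def atLeast0LessThan)
  ultimately show ?thesis
    by (simp add: mvn_density_def det_spiked_cov mat_inverse_spiked_cov quadratic_form_spiked_cov mat_inverse_one
        column_lr_def real_sqrt_mult exp_add[symmetric] diff_divide_distrib del: one_mult_mat_vec)
qed

lemma mvn_spiked_cov:
  assumes "0 \<le> \<beta>" and [measurable]: "x \<in> space (Pi\<^sub>M {..<n} (\<lambda>_. borel))"
  shows "mvn n (spiked_cov n \<beta> x) = density (mvn n (1\<^sub>m n)) (\<lambda>y. ennreal (column_lr n \<beta> x y))"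
proof -
  have [measurable]: "(\<lambda>y. ennreal (mvn_density n (1\<^sub>m n) y)) \<in> borel_measurable (Pi\<^sub>M {..<n} (\<lambda>_. lborel))"
    unfolding mvn_density_one by measurable
  have "column_lr n \<beta> x \<in> borel_measurable (Pi\<^sub>M {..<n} (\<lambda>_. borel))"
    unfolding column_lr_def by measurable
  also have "borel_measurable (Pi\<^sub>M {..<n} (\<lambda>_. borel :: real measure)) = borel_measurable (Pi\<^sub>M {..<n} (\<lambda>_. lborel))"
    by (intro measurable_cong_sets sets_PiM_cong) auto
  finally have [measurable]: "column_lr n \<beta> x \<in> borel_measurable (Pi\<^sub>M {..<n} (\<lambda>_. lborel))" .
  show ?thesis
    unfolding mvn_def
    by (subst density_density_eq)
      (auto simp: mvn_density_spiked_cov[OF assms(1)] column_lr_nonneg[OF assms(1)] ennreal_mult'' intro!: density_cong)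
qed

lemma nn_integral_exp_square_mvn_one:
  assumes "x \<in> space (Pi\<^sub>M {..<n} (\<lambda>_. borel))" "0 \<le> p" "p * dot n x x < 1"
  shows "(\<integral>\<^sup>+y. ennreal (exp (p / 2 * (dot n x y)\<^sup>2)) \<partial>mvn n (1\<^sub>m n))
       = ennreal (1 / sqrt (1 - p * dot n x x))"
  using nn_integral_exp_two_squares_mvn_one[of x n x p 0] assms by simp

lemma column_lr_measurable [measurable]:
  assumes [measurable]: "f \<in> measurable M (Pi\<^sub>M {..<n} (\<lambda>_. borel))" "g \<in> measurable M (Pi\<^sub>M {..<n} (\<lambda>_. borel))"
  shows "(\<lambda>w. column_lr n \<beta> (f w) (g w)) \<in> borel_measurable M"
  unfolding column_lr_def by measurable

subsection \<open>The likelihood ratio and its truncation\<close>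

text \<open>The total mass is the integral of \<open>column_lr\<close> under the standard law. With
  \<open>?s\<close> as quadratic coefficient, \<open>1 - ?s * ?a\<close> is the inverse of the
  determinant, and its root cancels the prefactor of \<open>column_lr\<close>.\<close>

lemma prob_space_mvn_spiked_cov:
  assumes \<beta>: "0 \<le> \<beta>" and x: "x \<in> space (Pi\<^sub>M {..<n} (\<lambda>_. borel))"
  shows "prob_space (mvn n (spiked_cov n \<beta> x))"
proof (rule prob_spaceI)
  note [measurable] = x
  let ?a = "dot n x x" let ?s = "\<beta> / (1 + \<beta> * ?a)"
  have a: "0 < 1 + \<beta> * ?a"
    using assms dot_self_nonneg[of n x] by (simp add: add_pos_nonneg)
  have s: "1 - ?s * ?a = 1 / (1 + \<beta> * ?a)" using a by (simp add: field_simps)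
  have "?s * ?a < 1" using a s by (smt (verit) divide_pos_pos)
  have "(\<integral>\<^sup>+y. ennreal (column_lr n \<beta> x y) \<partial>mvn n (1\<^sub>m n))
      = (\<integral>\<^sup>+y. ennreal (1 / sqrt (1 + \<beta> * ?a)) * ennreal (exp (?s / 2 * (dot n x y)\<^sup>2)) \<partial>mvn n (1\<^sub>m n))"
    using a by (simp add: column_lr_def ennreal_mult[symmetric])
  also have "\<dots> = ennreal (1 / sqrt (1 + \<beta> * ?a)) * ennreal (1 / sqrt (1 - ?s * ?a))"
    using a \<beta> x \<open>?s * ?a < 1\<close>
    by (subst nn_integral_cmult, simp, subst nn_integral_exp_square_mvn_one) auto
  also have "\<dots> = 1"
    unfolding s using a by (simp add: ennreal_mult[symmetric] real_sqrt_divide)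
  finally have "(\<integral>\<^sup>+y. ennreal (column_lr n \<beta> x y) \<partial>mvn n (1\<^sub>m n)) = 1" .
  then show "emeasure (mvn n (spiked_cov n \<beta> x)) (space (mvn n (spiked_cov n \<beta> x))) = 1"
    by (simp add: mvn_spiked_cov[OF \<beta> x] emeasure_density nn_integral_set_ennreal[symmetric] cong: nn_integral_cong)
qed

lemma sets_gaussian_columns [measurable_cong]:
  "sets (gaussian_columns n N S) = sets (Pi\<^sub>M {..<N} (\<lambda>_. Pi\<^sub>M {..<n} (\<lambda>_. borel)))"
  unfolding gaussian_columns_def by (intro sets_PiM_cong refl) (rule sets_mvn)

lemma prob_space_gaussian_columns_one: "prob_space (gaussian_columns n N (1\<^sub>m n))"
  unfolding gaussian_columns_def by (intro prob_space_PiM prob_space_mvn_one)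

definition likelihood_ratio :: "nat \<Rightarrow> nat \<Rightarrow> real \<Rightarrow> (nat \<Rightarrow> real) \<Rightarrow> (nat \<Rightarrow> nat \<Rightarrow> real) \<Rightarrow> real" where
  "likelihood_ratio n N \<beta> x D = (\<Prod>k<N. column_lr n \<beta> x (D k))"

lemma likelihood_ratio_nonneg: "0 \<le> \<beta> \<Longrightarrow> 0 \<le> likelihood_ratio n N \<beta> x D"
  by (simp add: likelihood_ratio_def prod_nonneg column_lr_nonneg)

lemma likelihood_ratio_measurable [measurable]:
  assumes [measurable]: "f \<in> measurable M (Pi\<^sub>M {..<n} (\<lambda>_. borel))"
    "g \<in> measurable M (Pi\<^sub>M {..<N} (\<lambda>_. Pi\<^sub>M {..<n} (\<lambda>_. borel)))"
  shows "(\<lambda>w. likelihood_ratio n N \<beta> (f w) (g w)) \<in> borel_measurable M"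
  unfolding likelihood_ratio_def by measurable

lemma gaussian_columns_spiked_cov:
  assumes \<beta>: "0 \<le> \<beta>" and x: "x \<in> space (Pi\<^sub>M {..<n} (\<lambda>_. borel))"
  shows "gaussian_columns n N (spiked_cov n \<beta> x)
    = density (gaussian_columns n N (1\<^sub>m n)) (\<lambda>D. ennreal (likelihood_ratio n N \<beta> x D))"
proof -
  note [measurable] = x
  have "gaussian_columns n N (spiked_cov n \<beta> x)
      = density (gaussian_columns n N (1\<^sub>m n)) (\<lambda>D. \<Prod>k<N. ennreal (column_lr n \<beta> x (D k)))"
    unfolding gaussian_columns_def mvn_spiked_cov[OF \<beta> x]
  proof (rule PiM_density)
    show "sigma_finite_measure (mvn n (1\<^sub>m n))"
      by (intro prob_space_imp_sigma_finite prob_space_mvn_one)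
    show "sigma_finite_measure (density (mvn n (1\<^sub>m n)) (\<lambda>y. ennreal (column_lr n \<beta> x y)))"
      unfolding mvn_spiked_cov[OF \<beta> x, symmetric]
      by (intro prob_space_imp_sigma_finite prob_space_mvn_spiked_cov \<beta> x)
  qed (simp, measurable)
  then show ?thesis
    by (simp add: likelihood_ratio_def prod_ennreal column_lr_nonneg[OF \<beta>])
qed

lemma prob_space_gaussian_columns_spiked_cov:
  assumes "0 \<le> \<beta>" "x \<in> space (Pi\<^sub>M {..<n} (\<lambda>_. borel))"
  shows "prob_space (gaussian_columns n N (spiked_cov n \<beta> x))"
  unfolding gaussian_columns_def by (intro prob_space_PiM prob_space_mvn_spiked_cov assms)

lemma nn_integral_prod_gaussian_columns:
  assumes [measurable]: "f \<in> borel_measurable (mvn n S)" and "sigma_finite_measure (mvn n S)"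
  shows "(\<integral>\<^sup>+D. (\<Prod>k<N. f (D k)) \<partial>gaussian_columns n N S) = (\<integral>\<^sup>+y. f y \<partial>mvn n S) ^ N"
proof -
  interpret product_sigma_finite "\<lambda>_::nat. mvn n S"
    using assms(2) by (simp add: product_sigma_finite_def)
  show ?thesis
    unfolding gaussian_columns_def by (subst product_nn_integral_prod) auto
qed

text \<open>Under the spiked law the energies \<open>(dot n x (D k))\<^sup>2\<close> have mean
  \<open>dot n x x * (1 + \<beta> * dot n x x)\<close>.\<close>

definition energy_bound :: "nat \<Rightarrow> real \<Rightarrow> real \<Rightarrow> (nat \<Rightarrow> real) \<Rightarrow> real" where
  "energy_bound n \<beta> \<delta> x = (1 + \<delta>) * (dot n x x * (1 + \<beta> * dot n x x))"

definition typical :: "nat \<Rightarrow> nat \<Rightarrow> real \<Rightarrow> real \<Rightarrow> (nat \<Rightarrow> real) \<Rightarrow> (nat \<Rightarrow> nat \<Rightarrow> real) \<Rightarrow> bool" where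
  "typical n N \<beta> \<delta> x D \<longleftrightarrow> (\<Sum>k<N. (dot n x (D k))\<^sup>2) \<le> real N * energy_bound n \<beta> \<delta> x"

lemma typical_measurable [measurable]:
  assumes [measurable]: "f \<in> measurable M (Pi\<^sub>M {..<n} (\<lambda>_. borel))"
    "g \<in> measurable M (Pi\<^sub>M {..<N} (\<lambda>_. Pi\<^sub>M {..<n} (\<lambda>_. borel)))"
  shows "Measurable.pred M (\<lambda>w. typical n N \<beta> \<delta> (f w) (g w))"
  unfolding typical_def energy_bound_def by measurable

section \<open>Chernoff bound for the energy under the spiked law\<close>

lemma dot_self_eq_0: "dot n x x = 0 \<Longrightarrow> dot n x y = 0"
  by (simp add: dot_def sum_nonneg_eq_0_iff)

text \<open>The left side is the spiked probability of the atypical event. There the weight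
  \<open>exp (\<eta> / 2 * (U - N * c))\<close>, with U the total energy, is at least 1; inserting
  it everywhere gives an integrand that factorises over the columns. After normalisation by the
  variance of \<open>dot n x y\<close> the computation no longer depends on \<open>x\<close>, hence
  neither does the bound.\<close>

lemma nn_integral_atypical_le:
  assumes \<beta>: "0 \<le> \<beta>" and \<delta>: "0 < \<delta>" and x: "x \<in> space (Pi\<^sub>M {..<n} (\<lambda>_. borel))"
  shows "(\<integral>\<^sup>+D. ennreal (likelihood_ratio n N \<beta> x D) * indicator {D. \<not> typical n N \<beta> \<delta> x D} D \<partial>gaussian_columns n N (1\<^sub>m n))
    \<le> ennreal (sqrt ((1 + \<delta>) * exp (- \<delta>)) ^ N)"
\<comment> \<open>For a vanishing spike all energies and the bound on them are 0, so no data matrix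
  is atypical; otherwise division by \<open>dot n x x\<close> is allowed.\<close>
proof (cases "dot n x x = 0")
  case True
  then have "typical n N \<beta> \<delta> x D" for D
    by (simp add: typical_def energy_bound_def dot_self_eq_0)
  then show ?thesis by simp
next
  case False
  note [measurable] = x
  define a where "a = dot n x x"
  have a: "a > 0" using False dot_self_nonneg[of n x] by (simp add: a_def)
  define b where "b = 1 + \<beta> * a"
  have b: "b > 0" using \<beta> a by (simp add: b_def add_pos_nonneg)
  \<comment> \<open>\<open>\<theta>\<close> is the optimal Chernoff exponent for exceeding the mean
    of a chi-squared variable by the factor \<open>1 + \<delta>\<close>; \<open>\<eta>\<close>
    rescales it by \<open>a * b\<close>, the variance of \<open>dot n x y\<close> under the spiked
    law.\<close>
  define \<theta> where "\<theta> = \<delta> / (1 + \<delta>)"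
  define \<eta> where "\<eta> = \<theta> / (a * b)"
  define c where "c = energy_bound n \<beta> \<delta> x"
  have \<eta>: "\<eta> > 0" using \<delta> a b by (simp add: \<eta>_def \<theta>_def)
  have \<eta>c: "\<eta> * c = \<delta>"
    using \<delta> a b by (simp add: \<eta>_def \<theta>_def c_def energy_bound_def a_def[symmetric] b_def[symmetric])
  have p: "1 - (\<beta> / b + \<eta>) * a = 1 / (b * (1 + \<delta>))"
  proof -
    have "\<eta> * a = \<theta> / b" using a by (simp add: \<eta>_def)
    then have "1 - (\<beta> / b + \<eta>) * a = (b - \<beta> * a - \<theta>) / b"
      using b by (simp add: field_simps)
    also have "b - \<beta> * a - \<theta> = 1 / (1 + \<delta>)"
      using \<delta> by (simp add: b_def \<theta>_def field_simps)
    finally show ?thesis by (simp add: mult.commute)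
  qed
  have p1: "(\<beta> / b + \<eta>) * a < 1"
    using p \<delta> b by (smt (verit) divide_pos_pos mult_pos_pos)
  let ?f = "\<lambda>y. ennreal (exp (- \<delta> / 2) / sqrt b) * ennreal (exp ((\<beta> / b + \<eta>) / 2 * (dot n x y)\<^sup>2))"
  have col: "column_lr n \<beta> x y * exp (\<eta> / 2 * ((dot n x y)\<^sup>2 - c))
      = exp (- \<delta> / 2) / sqrt b * exp ((\<beta> / b + \<eta>) / 2 * (dot n x y)\<^sup>2)" for y
  proof -
    have "\<beta> / b / 2 * u + \<eta> / 2 * (u - c) = - \<delta> / 2 + (\<beta> / b + \<eta>) / 2 * u" for u
      unfolding \<eta>c[symmetric] by (simp add: algebra_simps diff_divide_distrib)
    then show ?thesis
      by (simp add: column_lr_def a_def[symmetric] b_def[symmetric] exp_add[symmetric])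
  qed
  have "(\<integral>\<^sup>+D. ennreal (likelihood_ratio n N \<beta> x D) * indicator {D. \<not> typical n N \<beta> \<delta> x D} D \<partial>gaussian_columns n N (1\<^sub>m n))
      \<le> (\<integral>\<^sup>+D. (\<Prod>k<N. ?f (D k)) \<partial>gaussian_columns n N (1\<^sub>m n))"
  proof (intro nn_integral_mono)
    fix D
    have "(\<Prod>k<N. ?f (D k)) = (\<Prod>k<N. ennreal (column_lr n \<beta> x (D k) * exp (\<eta> / 2 * ((dot n x (D k))\<^sup>2 - c))))"
      unfolding col using b by (simp add: ennreal_mult[symmetric])
    also have "\<dots> = ennreal (likelihood_ratio n N \<beta> x D * exp (\<eta> / 2 * ((\<Sum>k<N. (dot n x (D k))\<^sup>2) - real N * c)))"
    proof -
      have "(\<Sum>k<N. \<eta> / 2 * ((dot n x (D k))\<^sup>2 - c)) = \<eta> / 2 * ((\<Sum>k<N. (dot n x (D k))\<^sup>2) - real N * c)"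
        by (subst sum_distrib_left[symmetric]) (simp add: sum_subtractf)
      then have "(\<Prod>k<N. exp (\<eta> / 2 * ((dot n x (D k))\<^sup>2 - c)))
          = exp (\<eta> / 2 * ((\<Sum>k<N. (dot n x (D k))\<^sup>2) - real N * c))"
        by (simp only: exp_sum[symmetric] finite_lessThan)
      then show ?thesis
        by (simp add: prod_ennreal column_lr_nonneg[OF \<beta>] prod.distrib likelihood_ratio_def)
    qed
    finally have *: "(\<Prod>k<N. ?f (D k)) = \<dots>" .
    show "ennreal (likelihood_ratio n N \<beta> x D) * indicator {D. \<not> typical n N \<beta> \<delta> x D} D \<le> (\<Prod>k<N. ?f (D k))"
    proof (cases "typical n N \<beta> \<delta> x D")
      case False
      then have "1 \<le> exp (\<eta> / 2 * ((\<Sum>k<N. (dot n x (D k))\<^sup>2) - real N * c))"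
        using \<eta> by (simp add: typical_def c_def)
      then have "likelihood_ratio n N \<beta> x D * 1
          \<le> likelihood_ratio n N \<beta> x D * exp (\<eta> / 2 * ((\<Sum>k<N. (dot n x (D k))\<^sup>2) - real N * c))"
        by (intro mult_left_mono likelihood_ratio_nonneg[OF \<beta>])
      then show ?thesis unfolding * using False by (simp add: ennreal_leI)
    qed simp
  qed
  also have "\<dots> = (\<integral>\<^sup>+y. ?f y \<partial>mvn n (1\<^sub>m n)) ^ N"
    by (rule nn_integral_prod_gaussian_columns) (auto intro: prob_space_imp_sigma_finite prob_space_mvn_one)
  also have "(\<integral>\<^sup>+y. ?f y \<partial>mvn n (1\<^sub>m n))
      = ennreal (exp (- \<delta> / 2) / sqrt b) * ennreal (1 / sqrt (1 - (\<beta> / b + \<eta>) * dot n x x))"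
    using \<beta> b \<eta> p1 x by (subst nn_integral_cmult, simp, subst nn_integral_exp_square_mvn_one) (auto simp: a_def)
  also have "\<dots> = ennreal (sqrt (1 + \<delta>) * exp (- \<delta> / 2))"
    unfolding a_def[symmetric] p using \<delta> b
    by (simp add: ennreal_mult[symmetric] real_sqrt_divide real_sqrt_mult)
  also have "sqrt (1 + \<delta>) * exp (- \<delta> / 2) = sqrt ((1 + \<delta>) * exp (- \<delta>))"
  proof -
    have "exp (- \<delta>) = (exp (- \<delta> / 2))\<^sup>2" by (simp add: power2_eq_square exp_add[symmetric])
    then show ?thesis by (simp add: real_sqrt_mult)
  qed
  finally show ?thesis using \<delta> by (simp add: ennreal_power)
qed

text \<open>With \<open>\<alpha> = \<beta> * dot n x x\<close>, the left side is the contribution of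
  one spike to the second moment per column; the bound is free of \<open>\<alpha>\<close>. The root
  is at most \<open>exp ((R - 1) / (1 + \<alpha>) / 2)\<close>, and replacing
  \<open>R + \<alpha>\<close> by \<open>1 + \<alpha>\<close> in the exponent only increases it. The
  resulting weights \<open>\<alpha> / (1 + \<alpha>)\<close> and \<open>1 / (1 + \<alpha>)\<close>
  add up to 1.\<close>

lemma tilted_factor_le:
  fixes \<alpha> R \<delta> :: real
  assumes "0 \<le> \<alpha>" "1 \<le> R" "0 \<le> \<delta>"
  shows "exp ((1 + \<delta>) * (\<alpha> * (R - 1) / (R + \<alpha>)) / 2) * sqrt ((R + \<alpha>) / (1 + \<alpha>)) \<le> exp ((1 + \<delta>) * (R - 1) / 2)"
proof -
  have exp_half: "exp z = (exp (z / 2))\<^sup>2" for z :: real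
    using exp_double[of "z / 2"] by simp
  have "(R + \<alpha>) / (1 + \<alpha>) = 1 + (R - 1) / (1 + \<alpha>)"
    using assms by (simp add: field_simps)
  also have "\<dots> \<le> exp ((R - 1) / (1 + \<alpha>))" by (rule exp_ge_add_one_self)
  also have "\<dots> = (exp ((R - 1) / (1 + \<alpha>) / 2))\<^sup>2"
    by (rule exp_half)
  finally have "sqrt ((R + \<alpha>) / (1 + \<alpha>)) \<le> exp ((R - 1) / (1 + \<alpha>) / 2)"
    by (rule real_le_lsqrt[rotated]) simp
  then have "exp ((1 + \<delta>) * (\<alpha> * (R - 1) / (R + \<alpha>)) / 2) * sqrt ((R + \<alpha>) / (1 + \<alpha>))
      \<le> exp ((1 + \<delta>) * (\<alpha> * (R - 1) / (R + \<alpha>)) / 2 + (R - 1) / (1 + \<alpha>) / 2)"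
    unfolding exp_add by (intro mult_left_mono) auto
  also have "\<dots> \<le> exp ((1 + \<delta>) * (R - 1) / 2)"
  proof -
    have "\<alpha> * (R - 1) / (R + \<alpha>) \<le> \<alpha> * (R - 1) / (1 + \<alpha>)"
      using assms by (intro divide_left_mono) auto
    then have "(1 + \<delta>) * (\<alpha> * (R - 1) / (R + \<alpha>)) \<le> (1 + \<delta>) * (\<alpha> * (R - 1) / (1 + \<alpha>))"
      using assms by (intro mult_left_mono) auto
    moreover have "(R - 1) / (1 + \<alpha>) \<le> (1 + \<delta>) * ((R - 1) / (1 + \<alpha>))"
      using assms by (intro mult_le_cancel_right1[THEN iffD2]) (auto simp: field_simps)
    moreover have "(1 + \<delta>) * (\<alpha> * (R - 1) / (1 + \<alpha>)) + (1 + \<delta>) * ((R - 1) / (1 + \<alpha>)) = (1 + \<delta>) * (R - 1)"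
    proof -
      have "\<alpha> * (R - 1) / (1 + \<alpha>) + (R - 1) / (1 + \<alpha>) = R - 1"
        using assms by (simp add: add_divide_distrib[symmetric]) (simp add: field_simps)
      then show ?thesis by (simp only: distrib_left[symmetric])
    qed
    ultimately have "(1 + \<delta>) * (\<alpha> * (R - 1) / (R + \<alpha>)) + (R - 1) / (1 + \<alpha>) \<le> (1 + \<delta>) * (R - 1)"
      by linarith
    moreover have "exp (u / 2 + v / 2) \<le> exp (w / 2)" if "u + v \<le> w" for u v w :: real
      using that by simp
    ultimately show ?thesis by blast
  qed
  finally show ?thesis .
qed

text \<open>The tilt \<open>\<beta> / (R + \<beta> * dot n x x)\<close> with \<open>R = sqrt (1 + \<beta>\<^sup>2 * (dot n x x')\<^sup>2)\<close> makes the
  determinant in the Gaussian integral factor as \<open>1 / ((R + \<beta> * dot n x x) * (R + \<beta> * dot n x' x'))\<close>.\<close>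

definition tilted_lr :: "nat \<Rightarrow> real \<Rightarrow> real \<Rightarrow> real \<Rightarrow> (nat \<Rightarrow> real) \<Rightarrow> (nat \<Rightarrow> real) \<Rightarrow> real" where
  "tilted_lr n \<beta> \<delta> R x y =
     exp ((1 + \<delta>) * (\<beta> * dot n x x * (R - 1) / (R + \<beta> * dot n x x)) / 2) / sqrt (1 + \<beta> * dot n x x)
     * exp (\<beta> / (R + \<beta> * dot n x x) / 2 * (dot n x y)\<^sup>2)"

lemma tilted_lr_nonneg: "0 \<le> \<beta> \<Longrightarrow> 0 \<le> tilted_lr n \<beta> \<delta> R x y"
  by (simp add: tilted_lr_def dot_self_nonneg)

text \<open>Since \<open>1 \<le> R\<close>, the tilt \<open>t\<close> is at most the true
  coefficient \<open>s\<close>. Splitting \<open>s * U\<close> into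
  \<open>(s - t) * U + t * U\<close>, the energy bound turns the first part into a constant, which
  is spread evenly over the columns.\<close>

lemma truncated_likelihood_ratio_le:
  assumes \<beta>: "0 \<le> \<beta>" and R: "1 \<le> R" and D: "typical n N \<beta> \<delta> x D"
  shows "likelihood_ratio n N \<beta> x D \<le> (\<Prod>k<N. tilted_lr n \<beta> \<delta> R x (D k))"
proof -
  define a where "a = dot n x x"
  have a: "0 \<le> a" by (simp add: a_def dot_self_nonneg)
  define U where "U = (\<Sum>k<N. (dot n x (D k))\<^sup>2)"
  define s where "s = \<beta> / (1 + \<beta> * a)"
  define t where "t = \<beta> / (R + \<beta> * a)"
  define c where "c = energy_bound n \<beta> \<delta> x"
  have pos: "0 < 1 + \<beta> * a" "0 < R + \<beta> * a" using \<beta> R a by (auto simp: add_pos_nonneg)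
  have "t \<le> s" unfolding s_def t_def using \<beta> R pos by (intro divide_left_mono) auto
  then have "(s - t) * U \<le> (s - t) * (real N * c)"
    using D by (intro mult_left_mono) (auto simp: typical_def U_def c_def)
  then have "s * U \<le> real N * ((s - t) * c) + t * U" by (simp add: algebra_simps)
  then have le: "s / 2 * U \<le> real N * ((s - t) * c / 2) + t / 2 * U" by simp
  \<comment> \<open>The factor \<open>1 + \<beta> * a\<close> of the energy bound cancels the
    denominator of \<open>s\<close>; this produces the exponent in the prefactor of
    \<open>tilted_lr\<close>.\<close>
  have "(s - t) * (1 + \<beta> * a) = \<beta> * (R - 1) / (R + \<beta> * a)"
  proof -
    have "(s - t) * (1 + \<beta> * a) = \<beta> - \<beta> * (1 + \<beta> * a) / (R + \<beta> * a)"
      using pos by (simp add: s_def t_def left_diff_distrib)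
    also have "\<dots> = \<beta> * (R - 1) / (R + \<beta> * a)"
      using pos by (simp add: field_simps)
    finally show ?thesis .
  qed
  then have "(1 + \<delta>) * (a * ((s - t) * (1 + \<beta> * a))) = (1 + \<delta>) * (\<beta> * a * (R - 1) / (R + \<beta> * a))"
    by (simp add: mult_ac)
  then have stc: "(s - t) * c = (1 + \<delta>) * (\<beta> * a * (R - 1) / (R + \<beta> * a))"
    by (simp add: c_def energy_bound_def a_def mult_ac)
  have "likelihood_ratio n N \<beta> x D = exp (s / 2 * U) / sqrt (1 + \<beta> * a) ^ N"
    by (simp add: likelihood_ratio_def column_lr_def a_def s_def U_def prod_dividef exp_sum[symmetric] sum_distrib_left)
  also have "\<dots> \<le> exp (real N * ((s - t) * c / 2) + t / 2 * U) / sqrt (1 + \<beta> * a) ^ N"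
    using pos le by (intro divide_right_mono) auto
  also have "\<dots> = (\<Prod>k<N. tilted_lr n \<beta> \<delta> R x (D k))"
    unfolding tilted_lr_def a_def[symmetric] stc[symmetric] t_def[symmetric]
    by (simp add: prod.distrib prod_dividef exp_add U_def exp_sum[symmetric] sum_distrib_left exp_of_nat_mult[symmetric] power_divide)
  finally show ?thesis .
qed

text \<open>Because \<open>R\<^sup>2 - \<beta>\<^sup>2 * (dot n x x')\<^sup>2 = 1\<close>, the
  determinant splits into one factor for each spike. Each is combined with its own prefactor and
  bounded by \<open>tilted_factor_le\<close>.\<close>

lemma nn_integral_tilted_lr_le:
  fixes n :: nat and x x' :: "nat \<Rightarrow> real" and \<beta> \<delta> :: real
  defines "R \<equiv> sqrt (1 + \<beta>\<^sup>2 * (dot n x x')\<^sup>2)"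
  assumes \<beta>: "0 \<le> \<beta>" and \<delta>: "0 \<le> \<delta>"
    and x: "x \<in> space (Pi\<^sub>M {..<n} (\<lambda>_. borel))" and x': "x' \<in> space (Pi\<^sub>M {..<n} (\<lambda>_. borel))"
  shows "(\<integral>\<^sup>+y. ennreal (tilted_lr n \<beta> \<delta> R x y * tilted_lr n \<beta> \<delta> R x' y) \<partial>mvn n (1\<^sub>m n))
    \<le> ennreal (exp ((1 + \<delta>) * \<beta>\<^sup>2 / 2 * (dot n x x')\<^sup>2))"
proof -
  note [measurable] = x x'
  define A B where "A = \<beta> * dot n x x" and "B = \<beta> * dot n x' x'"
  have AB: "0 \<le> A" "0 \<le> B" using \<beta> by (simp_all add: A_def B_def dot_self_nonneg)
  have R1: "1 \<le> R" unfolding R_def by simp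
  have R2: "R\<^sup>2 = 1 + \<beta>\<^sup>2 * (dot n x x')\<^sup>2" unfolding R_def by (simp add: add_nonneg_nonneg)
  have pos: "0 < R + A" "0 < R + B" using R1 AB by auto
  let ?p = "\<beta> / (R + A)" and ?q = "\<beta> / (R + B)"
  define e where "e \<alpha> = exp ((1 + \<delta>) * (\<alpha> * (R - 1) / (R + \<alpha>)) / 2)" for \<alpha>
  let ?C = "e A / sqrt (1 + A) * (e B / sqrt (1 + B))"
  have d: "(1 - ?p * dot n x x) * (1 - ?q * dot n x' x') - ?p * ?q * (dot n x x')\<^sup>2 = 1 / ((R + A) * (R + B))"
  proof -
    have "1 - ?p * dot n x x = R / (R + A)" "1 - ?q * dot n x' x' = R / (R + B)"
      using pos by (simp_all add: A_def B_def field_simps)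
    then have "(1 - ?p * dot n x x) * (1 - ?q * dot n x' x') - ?p * ?q * (dot n x x')\<^sup>2
        = (R\<^sup>2 - \<beta>\<^sup>2 * (dot n x x')\<^sup>2) / ((R + A) * (R + B))"
      by (simp add: power2_eq_square diff_divide_distrib)
    then show ?thesis by (simp add: R2)
  qed
  have p1: "?p * dot n x x < 1"
    using pos R1 by (simp add: A_def field_simps)
  have two: "(\<integral>\<^sup>+y. ennreal (exp (?p / 2 * (dot n x y)\<^sup>2 + ?q / 2 * (dot n x' y)\<^sup>2)) \<partial>mvn n (1\<^sub>m n))
      = ennreal (1 / sqrt (1 / ((R + A) * (R + B))))"
    using nn_integral_exp_two_squares_mvn_one[OF x x' _ p1, of ?q] \<beta> pos unfolding d by simp
  have "tilted_lr n \<beta> \<delta> R x y * tilted_lr n \<beta> \<delta> R x' y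
      = ?C * exp (?p / 2 * (dot n x y)\<^sup>2 + ?q / 2 * (dot n x' y)\<^sup>2)" for y
    by (simp add: tilted_lr_def A_def[symmetric] B_def[symmetric] e_def exp_add)
  then have "(\<integral>\<^sup>+y. ennreal (tilted_lr n \<beta> \<delta> R x y * tilted_lr n \<beta> \<delta> R x' y) \<partial>mvn n (1\<^sub>m n))
      = (\<integral>\<^sup>+y. ennreal ?C * ennreal (exp (?p / 2 * (dot n x y)\<^sup>2 + ?q / 2 * (dot n x' y)\<^sup>2)) \<partial>mvn n (1\<^sub>m n))"
    using AB by (simp add: ennreal_mult[symmetric] e_def)
  also have "\<dots> = ennreal ?C * ennreal (1 / sqrt (1 / ((R + A) * (R + B))))"
    by (subst nn_integral_cmult, simp, simp only: two)
  also have "\<dots> = ennreal ((e A * sqrt ((R + A) / (1 + A))) * (e B * sqrt ((R + B) / (1 + B))))"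
    using AB pos by (simp add: ennreal_mult[symmetric] e_def real_sqrt_divide real_sqrt_mult mult_ac)
  also have "\<dots> \<le> ennreal (exp ((1 + \<delta>) * (R - 1) / 2) * exp ((1 + \<delta>) * (R - 1) / 2))"
    unfolding e_def using AB R1 \<delta>
    by (intro ennreal_leI mult_mono tilted_factor_le) auto
  also have "\<dots> \<le> ennreal (exp ((1 + \<delta>) * \<beta>\<^sup>2 / 2 * (dot n x x')\<^sup>2))"
  proof -
    \<comment> \<open>Expanded, this says that \<open>R - 1\<close> is at most
      \<open>(R\<^sup>2 - 1) / 2\<close>, which is quadratic in the overlap
      \<open>dot n x x'\<close>.\<close>
    have "0 \<le> (R - 1)\<^sup>2" by simp
    then have "R - 1 \<le> \<beta>\<^sup>2 * (dot n x x')\<^sup>2 / 2"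
      unfolding power2_diff R2 by simp
    then have "(1 + \<delta>) * (R - 1) \<le> (1 + \<delta>) * (\<beta>\<^sup>2 * (dot n x x')\<^sup>2 / 2)"
      using \<delta> by (intro mult_left_mono) auto
    then show ?thesis by (simp add: exp_add[symmetric] ennreal_leI mult_ac)
  qed
  finally show ?thesis .
qed

definition truncated_lr :: "nat \<Rightarrow> nat \<Rightarrow> real \<Rightarrow> real \<Rightarrow> (nat \<Rightarrow> real) \<Rightarrow> (nat \<Rightarrow> nat \<Rightarrow> real) \<Rightarrow> real" where
  "truncated_lr n N \<beta> \<delta> x D = (if typical n N \<beta> \<delta> x D then likelihood_ratio n N \<beta> x D else 0)"

lemma truncated_lr_measurable [measurable]:
  assumes [measurable]: "f \<in> measurable M (Pi\<^sub>M {..<n} (\<lambda>_. borel))"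
    "g \<in> measurable M (Pi\<^sub>M {..<N} (\<lambda>_. Pi\<^sub>M {..<n} (\<lambda>_. borel)))"
  shows "(\<lambda>w. truncated_lr n N \<beta> \<delta> (f w) (g w)) \<in> borel_measurable M"
  unfolding truncated_lr_def by measurable

text \<open>The pointwise domination by tilted ratios holds for every \<open>R\<close> with
  \<open>1 \<le> R\<close>, so \<open>R\<close> may depend on the pair of spikes. Independence of
  the columns then gives the \<open>N\<close>-th power of the bound for one column.\<close>

lemma nn_integral_truncated_lr_mult_le:
  assumes \<beta>: "0 \<le> \<beta>" and \<delta>: "0 \<le> \<delta>"
    and x: "x \<in> space (Pi\<^sub>M {..<n} (\<lambda>_. borel))" and x': "x' \<in> space (Pi\<^sub>M {..<n} (\<lambda>_. borel))"
  shows "(\<integral>\<^sup>+D. ennreal (truncated_lr n N \<beta> \<delta> x D) * ennreal (truncated_lr n N \<beta> \<delta> x' D) \<partial>gaussian_columns n N (1\<^sub>m n))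
    \<le> ennreal (exp (real N * (1 + \<delta>) * \<beta>\<^sup>2 / 2 * (dot n x x')\<^sup>2))"
proof -
  note [measurable] = x x'
  define R where "R = sqrt (1 + \<beta>\<^sup>2 * (dot n x x')\<^sup>2)"
  have R: "1 \<le> R" unfolding R_def by simp
  have tr: "truncated_lr n N \<beta> \<delta> z D \<le> (\<Prod>k<N. tilted_lr n \<beta> \<delta> R z (D k))" for z D
    using truncated_likelihood_ratio_le[OF \<beta> R, of n N \<delta> z D]
    by (auto simp: truncated_lr_def tilted_lr_nonneg[OF \<beta>] intro!: prod_nonneg)
  have [measurable]: "tilted_lr n \<beta> \<delta> R z \<in> borel_measurable (mvn n (1\<^sub>m n))"
    if "z \<in> space (Pi\<^sub>M {..<n} (\<lambda>_. borel))" for z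
    using that unfolding tilted_lr_def by measurable
  have "(\<integral>\<^sup>+D. ennreal (truncated_lr n N \<beta> \<delta> x D) * ennreal (truncated_lr n N \<beta> \<delta> x' D) \<partial>gaussian_columns n N (1\<^sub>m n))
      \<le> (\<integral>\<^sup>+D. (\<Prod>k<N. ennreal (tilted_lr n \<beta> \<delta> R x (D k) * tilted_lr n \<beta> \<delta> R x' (D k))) \<partial>gaussian_columns n N (1\<^sub>m n))"
  proof (intro nn_integral_mono)
    fix D
    have "ennreal (truncated_lr n N \<beta> \<delta> x D) * ennreal (truncated_lr n N \<beta> \<delta> x' D)
        \<le> ennreal (\<Prod>k<N. tilted_lr n \<beta> \<delta> R x (D k)) * ennreal (\<Prod>k<N. tilted_lr n \<beta> \<delta> R x' (D k))"
      by (intro mult_mono ennreal_leI tr) auto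
    also have "\<dots> = (\<Prod>k<N. ennreal (tilted_lr n \<beta> \<delta> R x (D k) * tilted_lr n \<beta> \<delta> R x' (D k)))"
      by (simp add: prod_ennreal tilted_lr_nonneg[OF \<beta>] prod_nonneg prod.distrib ennreal_mult)
    finally show "ennreal (truncated_lr n N \<beta> \<delta> x D) * ennreal (truncated_lr n N \<beta> \<delta> x' D)
        \<le> (\<Prod>k<N. ennreal (tilted_lr n \<beta> \<delta> R x (D k) * tilted_lr n \<beta> \<delta> R x' (D k)))" .
  qed
  also have "\<dots> = (\<integral>\<^sup>+y. ennreal (tilted_lr n \<beta> \<delta> R x y * tilted_lr n \<beta> \<delta> R x' y) \<partial>mvn n (1\<^sub>m n)) ^ N"
    using x x' by (intro nn_integral_prod_gaussian_columns prob_space_imp_sigma_finite prob_space_mvn_one) measurable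
  also have "\<dots> \<le> ennreal (exp ((1 + \<delta>) * \<beta>\<^sup>2 / 2 * (dot n x x')\<^sup>2)) ^ N"
    unfolding R_def by (intro power_mono nn_integral_tilted_lr_le assms) auto
  also have "\<dots> = ennreal (exp (real N * (1 + \<delta>) * \<beta>\<^sup>2 / 2 * (dot n x x')\<^sup>2))"
    by (simp add: ennreal_power exp_of_nat_mult[symmetric] mult_ac)
  finally show ?thesis .
qed

subsection \<open>Second moment bound\<close>

text \<open>The square is linearised once more: \<open>exp (\<kappa> / 2 * Z\<^sup>2)\<close> is the
  average of \<open>exp (sqrt \<kappa> * Z * g)\<close> over a standard Gaussian \<open>g\<close>.
  For fixed \<open>g\<close> the subgaussian bound applies, and the Gaussian integral that remains
  converges because \<open>\<kappa> * s < 1\<close>.\<close>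

lemma subgaussian_nn_integral_exp_square_le:
  assumes "prob_space M" and Z: "subgaussian M s Z" and \<kappa>: "0 \<le> \<kappa>" "\<kappa> * s < 1"
  shows "(\<integral>\<^sup>+\<omega>. ennreal (exp (\<kappa> / 2 * (Z \<omega>)\<^sup>2)) \<partial>M) \<le> ennreal (1 / sqrt (1 - \<kappa> * s))"
proof -
  interpret prob_space M by fact
  interpret pair: pair_sigma_finite std_normal M by standard
  have [measurable]: "Z \<in> borel_measurable M"
    using Z by (auto simp: subgaussian_def)
  have "ennreal (exp (\<kappa> / 2 * (Z \<omega>)\<^sup>2)) = (\<integral>\<^sup>+g. ennreal (exp (sqrt \<kappa> * Z \<omega> * g)) \<partial>std_normal)" for \<omega>
    using nn_integral_exp_linear_std_normal[of "sqrt \<kappa> * Z \<omega>"] \<kappa> by (simp add: power_mult_distrib)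
  then have "(\<integral>\<^sup>+\<omega>. ennreal (exp (\<kappa> / 2 * (Z \<omega>)\<^sup>2)) \<partial>M)
      = (\<integral>\<^sup>+\<omega>. \<integral>\<^sup>+g. ennreal (exp (sqrt \<kappa> * Z \<omega> * g)) \<partial>std_normal \<partial>M)"
    by simp
  also have "\<dots> = (\<integral>\<^sup>+g. \<integral>\<^sup>+\<omega>. ennreal (exp (sqrt \<kappa> * Z \<omega> * g)) \<partial>M \<partial>std_normal)"
    by (rule pair.Fubini') measurable
  also have "\<dots> \<le> (\<integral>\<^sup>+g. ennreal (exp (\<kappa> * s / 2 * g\<^sup>2 + 0 * g)) \<partial>std_normal)"
  proof (intro nn_integral_mono)
    fix g
    have "(\<integral>\<^sup>+\<omega>. ennreal (exp ((sqrt \<kappa> * g) * Z \<omega>)) \<partial>M) = ennreal (\<integral>\<omega>. exp ((sqrt \<kappa> * g) * Z \<omega>) \<partial>M)"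
      using Z by (intro nn_integral_eq_integral) (auto simp: subgaussian_def)
    also have "\<dots> \<le> ennreal (exp (s * (sqrt \<kappa> * g)\<^sup>2 / 2))"
      using Z by (intro ennreal_leI) (simp add: subgaussian_def)
    also have "s * (sqrt \<kappa> * g)\<^sup>2 / 2 = \<kappa> * s / 2 * g\<^sup>2 + 0 * g"
      using \<kappa> by (simp add: power_mult_distrib)
    finally show "(\<integral>\<^sup>+\<omega>. ennreal (exp (sqrt \<kappa> * Z \<omega> * g)) \<partial>M) \<le> ennreal (exp (\<kappa> * s / 2 * g\<^sup>2 + 0 * g))"
      by (simp add: mult_ac)
  qed
  also have "\<dots> = ennreal (1 / sqrt (1 - \<kappa> * s))"
    by (subst nn_integral_exp_quadratic_std_normal[OF \<kappa>(2)]) simp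
  finally show ?thesis .
qed

text \<open>Cauchy-Schwarz for the mixture \<open>F\<close> against the indicator of
  \<open>A\<close>. The square of \<open>F\<close> is written with two independent copies
  \<open>x\<close> and \<open>x'\<close> of the mixing variable, so that its integral becomes the
  averaged pair moment in the hypothesis.\<close>

lemma nn_integral_mixture_le:
  fixes f :: "'a \<Rightarrow> 'b \<Rightarrow> ennreal"
  assumes "prob_space X" "prob_space P" and A[measurable]: "A \<in> sets P"
    and f[measurable]: "(\<lambda>(x, D). f x D) \<in> borel_measurable (X \<Otimes>\<^sub>M P)"
    and le: "(\<integral>\<^sup>+x. \<integral>\<^sup>+x'. \<integral>\<^sup>+D. f x D * f x' D \<partial>P \<partial>X \<partial>X) \<le> C"
  shows "(\<integral>\<^sup>+x. \<integral>\<^sup>+D. f x D * indicator A D \<partial>P \<partial>X)\<^sup>2 \<le> emeasure P A * C"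
proof -
  interpret X: prob_space X by fact
  interpret P: prob_space P by fact
  interpret pair: pair_sigma_finite X P by standard
  define F where "F D = (\<integral>\<^sup>+x. f x D \<partial>X)" for D
  have [measurable]: "(\<lambda>(D, x). f x D) \<in> borel_measurable (P \<Otimes>\<^sub>M X)"
    using measurable_pair_swap[OF f] by simp
  have [measurable]: "F \<in> borel_measurable P" unfolding F_def by measurable
  have "(\<integral>\<^sup>+x. \<integral>\<^sup>+D. f x D * indicator A D \<partial>P \<partial>X) = (\<integral>\<^sup>+D. \<integral>\<^sup>+x. f x D * indicator A D \<partial>X \<partial>P)"
    by (rule pair.Fubini'[symmetric]) measurable
  also have "\<dots> = (\<integral>\<^sup>+D. F D * indicator A D \<partial>P)"
    unfolding F_def by (intro nn_integral_cong nn_integral_multc) measurable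
  finally have "(\<integral>\<^sup>+x. \<integral>\<^sup>+D. f x D * indicator A D \<partial>P \<partial>X)\<^sup>2
      \<le> (\<integral>\<^sup>+D. (F D)\<^sup>2 \<partial>P) * (\<integral>\<^sup>+D. (indicator A D)\<^sup>2 \<partial>P)"
    using Cauchy_Schwarz_nn_integral[of F P "indicator A"] by simp
  also have "(\<integral>\<^sup>+D. (indicator A D)\<^sup>2 \<partial>P) = emeasure P A"
  proof -
    have "(indicator A D :: ennreal)\<^sup>2 = indicator A D" for D by (simp add: indicator_def)
    then show ?thesis by simp
  qed
  also have "(\<integral>\<^sup>+D. (F D)\<^sup>2 \<partial>P) = (\<integral>\<^sup>+D. \<integral>\<^sup>+x. f x D * F D \<partial>X \<partial>P)"
    unfolding power2_eq_square by (intro nn_integral_cong, subst nn_integral_multc) (auto simp: F_def)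
  also have "\<dots> = (\<integral>\<^sup>+x. \<integral>\<^sup>+D. f x D * F D \<partial>P \<partial>X)"
    by (rule pair.Fubini') measurable
  also have "\<dots> = (\<integral>\<^sup>+x. \<integral>\<^sup>+D. \<integral>\<^sup>+x'. f x D * f x' D \<partial>X \<partial>P \<partial>X)"
    unfolding F_def by (intro nn_integral_cong nn_integral_cmult[symmetric]) measurable
  also have "\<dots> = (\<integral>\<^sup>+x. \<integral>\<^sup>+x'. \<integral>\<^sup>+D. f x D * f x' D \<partial>P \<partial>X \<partial>X)"
    by (intro nn_integral_cong pair.Fubini') measurable
  also have "\<dots> \<le> C" by fact
  finally show ?thesis by (simp add: mult_right_mono mult.commute)
qed

text \<open>This makes the law a kernel, as needed to evaluate the monadic bind. Dependence on
  \<open>x\<close> through the inverse covariance matrix is replaced by the likelihood ratio, which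
  is jointly measurable in \<open>x\<close> and the data.\<close>

lemma measurable_gaussian_columns_spiked_cov:
  assumes \<beta>: "0 \<le> \<beta>" and X: "sets X = sets (Pi\<^sub>M {..<n} (\<lambda>_. borel))"
  shows "(\<lambda>x. gaussian_columns n N (spiked_cov n \<beta> x)) \<in> X \<rightarrow>\<^sub>M subprob_algebra (gaussian_columns n N (1\<^sub>m n))"
proof (rule measurable_subprob_algebra)
  note [measurable_cong] = X
  let ?P = "gaussian_columns n N (1\<^sub>m n)"
  interpret P: prob_space ?P by (rule prob_space_gaussian_columns_one)
  have space: "space X = space (Pi\<^sub>M {..<n} (\<lambda>_. borel))" using X by (rule sets_eq_imp_space_eq)
  show "subprob_space (gaussian_columns n N (spiked_cov n \<beta> x))" if "x \<in> space X" for x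
    using that by (intro prob_space_imp_subprob_space prob_space_gaussian_columns_spiked_cov \<beta>) (simp add: space)
  show "sets (gaussian_columns n N (spiked_cov n \<beta> x)) = sets ?P" for x
    by (simp add: sets_gaussian_columns)
  fix A assume [measurable]: "A \<in> sets ?P"
  have "(\<lambda>x. \<integral>\<^sup>+D. ennreal (likelihood_ratio n N \<beta> x D) * indicator A D \<partial>?P) \<in> borel_measurable X"
    by measurable
  moreover have "emeasure (gaussian_columns n N (spiked_cov n \<beta> x)) A
      = (\<integral>\<^sup>+D. ennreal (likelihood_ratio n N \<beta> x D) * indicator A D \<partial>?P)" if "x \<in> space X" for x
  proof -
    have x[measurable]: "x \<in> space (Pi\<^sub>M {..<n} (\<lambda>_. borel))" using that by (simp add: space)
    show ?thesis
      by (subst gaussian_columns_spiked_cov[OF \<beta> x], subst emeasure_density) (auto, measurable)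
  qed
  ultimately show "(\<lambda>x. emeasure (gaussian_columns n N (spiked_cov n \<beta> x)) A) \<in> borel_measurable X"
    by (simp cong: measurable_cong)
qed

text \<open>The event is split along typicality. The atypical part is bounded uniformly in the spike
  by the Chernoff estimate, the typical part by Cauchy-Schwarz and the second moment
  \<open>C\<close> of the truncated ratios.\<close>

lemma measure_bind_gaussian_columns_le:
  fixes C :: real
  assumes \<beta>: "0 \<le> \<beta>" and \<delta>: "0 < \<delta>" and C: "0 \<le> C"
    and "prob_space X" and X: "sets X = sets (Pi\<^sub>M {..<n} (\<lambda>_. borel))"
    and moment: "(\<integral>\<^sup>+x. \<integral>\<^sup>+x'. ennreal (exp (real N * (1 + \<delta>) * \<beta>\<^sup>2 / 2 * (dot n x x')\<^sup>2)) \<partial>X \<partial>X) \<le> ennreal C"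
    and A: "A \<in> sets (gaussian_columns n N (1\<^sub>m n))"
  shows "measure (X \<bind> (\<lambda>x. gaussian_columns n N (spiked_cov n \<beta> x))) A
    \<le> sqrt ((1 + \<delta>) * exp (- \<delta>)) ^ N + sqrt (measure (gaussian_columns n N (1\<^sub>m n)) A * C)"
proof -
  note [measurable_cong] = X and [measurable] = A
  let ?P = "gaussian_columns n N (1\<^sub>m n)" and ?Q = "\<lambda>x. gaussian_columns n N (spiked_cov n \<beta> x)"
  define \<rho> where "\<rho> = sqrt ((1 + \<delta>) * exp (- \<delta>)) ^ N"
  have \<rho>: "0 \<le> \<rho>" using \<delta> by (simp add: \<rho>_def)
  interpret X: prob_space X by fact
  interpret P: prob_space ?P by (rule prob_space_gaussian_columns_one)
  have space: "space X = space (Pi\<^sub>M {..<n} (\<lambda>_. borel))" using X by (rule sets_eq_imp_space_eq)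
  define T where "T = (\<integral>\<^sup>+x. \<integral>\<^sup>+D. ennreal (truncated_lr n N \<beta> \<delta> x D) * indicator A D \<partial>?P \<partial>X)"
  have "emeasure (X \<bind> ?Q) A = (\<integral>\<^sup>+x. emeasure (?Q x) A \<partial>X)"
    by (rule emeasure_bind[OF X.not_empty measurable_gaussian_columns_spiked_cov[OF \<beta> X] A])
  also have "\<dots> \<le> (\<integral>\<^sup>+x. ennreal \<rho> + (\<integral>\<^sup>+D. ennreal (truncated_lr n N \<beta> \<delta> x D) * indicator A D \<partial>?P) \<partial>X)"
  proof (intro nn_integral_mono)
    fix x assume "x \<in> space X"
    then have x[measurable]: "x \<in> space (Pi\<^sub>M {..<n} (\<lambda>_. borel))" by (simp add: space)
    have "emeasure (?Q x) A = (\<integral>\<^sup>+D. ennreal (likelihood_ratio n N \<beta> x D) * indicator A D \<partial>?P)"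
      by (subst gaussian_columns_spiked_cov[OF \<beta> x], subst emeasure_density) (auto, measurable)
    \<comment> \<open>On \<open>A\<close> the ratio is either truncated away, hence covered by the
      first summand, or equal to its truncation. In the first summand the restriction to
      \<open>A\<close> is dropped.\<close>
    also have "\<dots> \<le> (\<integral>\<^sup>+D. ennreal (likelihood_ratio n N \<beta> x D) * indicator {D. \<not> typical n N \<beta> \<delta> x D} D
        + ennreal (truncated_lr n N \<beta> \<delta> x D) * indicator A D \<partial>?P)"
      by (intro nn_integral_mono) (auto simp: truncated_lr_def indicator_def)
    also have "\<dots> = (\<integral>\<^sup>+D. ennreal (likelihood_ratio n N \<beta> x D) * indicator {D. \<not> typical n N \<beta> \<delta> x D} D \<partial>?P)
        + (\<integral>\<^sup>+D. ennreal (truncated_lr n N \<beta> \<delta> x D) * indicator A D \<partial>?P)"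
      by (intro nn_integral_add) measurable
    also have "\<dots> \<le> ennreal \<rho> + (\<integral>\<^sup>+D. ennreal (truncated_lr n N \<beta> \<delta> x D) * indicator A D \<partial>?P)"
      unfolding \<rho>_def by (intro add_right_mono nn_integral_atypical_le \<beta> \<delta> x)
    finally show "emeasure (?Q x) A \<le> \<dots>" .
  qed
  also have "\<dots> = ennreal \<rho> + T"
    unfolding T_def by (subst nn_integral_add) (auto simp: X.emeasure_space_1)
  also have "T \<le> ennreal (sqrt (measure ?P A * C))"
  proof -
    have "T\<^sup>2 \<le> emeasure ?P A * ennreal C"
      unfolding T_def
    proof (rule nn_integral_mixture_le)
      show "(\<lambda>(x, D). ennreal (truncated_lr n N \<beta> \<delta> x D)) \<in> borel_measurable (X \<Otimes>\<^sub>M ?P)"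
        by measurable
      have "(\<integral>\<^sup>+x. \<integral>\<^sup>+x'. \<integral>\<^sup>+D. ennreal (truncated_lr n N \<beta> \<delta> x D) * ennreal (truncated_lr n N \<beta> \<delta> x' D) \<partial>?P \<partial>X \<partial>X)
          \<le> (\<integral>\<^sup>+x. \<integral>\<^sup>+x'. ennreal (exp (real N * (1 + \<delta>) * \<beta>\<^sup>2 / 2 * (dot n x x')\<^sup>2)) \<partial>X \<partial>X)"
        using \<beta> \<delta> by (intro nn_integral_mono nn_integral_truncated_lr_mult_le) (auto simp: space)
      then show "(\<integral>\<^sup>+x. \<integral>\<^sup>+x'. \<integral>\<^sup>+D. ennreal (truncated_lr n N \<beta> \<delta> x D) * ennreal (truncated_lr n N \<beta> \<delta> x' D) \<partial>?P \<partial>X \<partial>X) \<le> ennreal C"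
        using moment by (rule order_trans)
    qed (fact X.prob_space_axioms P.prob_space_axioms A)+
    then have T2: "T\<^sup>2 \<le> ennreal (measure ?P A * C)"
      using C by (simp add: P.emeasure_eq_measure ennreal_mult)
    then show ?thesis
    \<comment> \<open>An infinite \<open>T\<close> would contradict the finite bound on its square;
      a finite one allows the root to be taken among the reals.\<close>
    proof (cases T)
      case (real r)
      with T2 C have "r\<^sup>2 \<le> measure ?P A * C" by (simp add: ennreal_power)
      then show ?thesis using real by (simp add: ennreal_leI real_le_rsqrt)
    qed (simp add: power2_eq_square ennreal_top_mult top_unique)
  qed
  finally have "emeasure (X \<bind> ?Q) A \<le> ennreal (\<rho> + sqrt (measure ?P A * C))"
    using \<rho> C by (simp add: add_left_mono)
  then show ?thesis
    unfolding \<rho>_def[symmetric] using \<rho> C by (simp add: measure_def enn2real_leI)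
qed

section \<open>From data matrices to sample covariances\<close>

lemma sample_covariance_measurable [measurable]:
  "sample_covariance n N \<in> gaussian_columns n N S \<rightarrow>\<^sub>M Pi\<^sub>M ({..<n} \<times> {..<n}) (\<lambda>_. borel)"
proof -
  have "(\<lambda>D. \<lambda>ij\<in>{..<n} \<times> {..<n}. 1 / real N * (\<Sum>k<N. D k (fst ij) * D k (snd ij)))
      \<in> gaussian_columns n N S \<rightarrow>\<^sub>M Pi\<^sub>M ({..<n} \<times> {..<n}) (\<lambda>_. borel)"
  proof (rule measurable_restrict)
    fix ij assume "ij \<in> {..<n} \<times> {..<n}"
    then have ij: "fst ij \<in> {..<n}" "snd ij \<in> {..<n}" by auto
    have entry: "(\<lambda>D. D k i) \<in> borel_measurable (gaussian_columns n N S)"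
      if "k \<in> {..<N}" "i \<in> {..<n}" for k i
      unfolding measurable_cong_sets[OF sets_gaussian_columns refl]
      by (rule measurable_compose[OF measurable_component_singleton[OF that(1)] measurable_component_singleton[OF that(2)]])
    show "(\<lambda>D. 1 / real N * (\<Sum>k<N. D k (fst ij) * D k (snd ij))) \<in> borel_measurable (gaussian_columns n N S)"
      by (intro borel_measurable_times borel_measurable_const borel_measurable_sum entry ij)
  qed
  moreover have "sample_covariance n N
      = (\<lambda>D. \<lambda>ij\<in>{..<n} \<times> {..<n}. 1 / real N * (\<Sum>k<N. D k (fst ij) * D k (snd ij)))"
    unfolding sample_covariance_def by (intro ext) (auto simp: restrict_def)
  ultimately show ?thesis by simp
qed

text \<open>Both Wishart laws are images under the same map, so \<open>B\<close> pulls back to one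
  event \<open>A\<close> of data matrices. The subgaussian bound with
  \<open>\<kappa> = N * (1 + \<delta>) * \<beta>\<^sup>2\<close> supplies the second moment, and
  \<open>\<tau>\<close> makes that constant uniform in the dimension.\<close>

lemma measure_spiked_wishart_le:
  assumes \<beta>: "0 \<le> \<beta>" and \<delta>: "0 < \<delta>"
    and "prob_space X" and X: "sets X = sets (Pi\<^sub>M {..<n} (\<lambda>_. borel))"
    and sub: "subgaussian (X \<Otimes>\<^sub>M X) s (\<lambda>(x, x'). \<Sum>i<n. x i * x' i)"
    and \<tau>: "real N * (1 + \<delta>) * \<beta>\<^sup>2 * s \<le> \<tau>" "\<tau> < 1"
    and B: "B \<in> sets (wishart n N)"
  shows "measure (spiked_wishart n N \<beta> X) B
    \<le> sqrt ((1 + \<delta>) * exp (- \<delta>)) ^ N + sqrt (measure (wishart n N) B / sqrt (1 - \<tau>))"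
proof -
  interpret X: prob_space X by fact
  interpret XX: pair_prob_space X X by standard
  note [measurable_cong] = X
  let ?P = "gaussian_columns n N (1\<^sub>m n)" and ?Q = "\<lambda>x. gaussian_columns n N (spiked_cov n \<beta> x)"
  let ?M = "Pi\<^sub>M ({..<n} \<times> {..<n}) (\<lambda>_. borel :: real measure)"
  let ?k = "real N * (1 + \<delta>) * \<beta>\<^sup>2"
  have B: "B \<in> sets ?M" using B by (simp add: wishart_def)
  define A where "A = sample_covariance n N -` B \<inter> space ?P"
  have A: "A \<in> sets ?P" unfolding A_def by (rule measurable_sets[OF sample_covariance_measurable B])
  have sets_Q: "sets (X \<bind> ?Q) = sets ?P"
    by (rule sets_bind_measurable[OF measurable_gaussian_columns_spiked_cov[OF \<beta> X] X.not_empty])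
  have sc: "sample_covariance n N \<in> (X \<bind> ?Q) \<rightarrow>\<^sub>M ?M"
    using sample_covariance_measurable by (simp cong: measurable_cong_sets add: measurable_cong_sets[OF sets_Q refl])
  have PA: "measure (wishart n N) B = measure ?P A"
    unfolding wishart_def A_def by (rule measure_distr[OF sample_covariance_measurable B])
  have QA: "measure (spiked_wishart n N \<beta> X) B = measure (X \<bind> ?Q) A"
    unfolding spiked_wishart_def A_def sets_eq_imp_space_eq[OF sets_Q, symmetric] by (rule measure_distr[OF sc B])
  have "(\<integral>\<^sup>+x. \<integral>\<^sup>+x'. ennreal (exp (?k / 2 * (dot n x x')\<^sup>2)) \<partial>X \<partial>X)
      = (\<integral>\<^sup>+z. ennreal (exp (?k / 2 * (dot n (fst z) (snd z))\<^sup>2)) \<partial>(X \<Otimes>\<^sub>M X))"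
    by (subst X.nn_integral_fst[symmetric]) auto
  also have "\<dots> = (\<integral>\<^sup>+z. ennreal (exp (?k / 2 * ((\<lambda>(x, x'). \<Sum>i<n. x i * x' i) z)\<^sup>2)) \<partial>(X \<Otimes>\<^sub>M X))"
    by (simp add: dot_def split_beta)
  also have "\<dots> \<le> ennreal (1 / sqrt (1 - ?k * s))"
    using \<delta> \<tau> by (intro subgaussian_nn_integral_exp_square_le XX.prob_space_axioms sub) auto
  also have "\<dots> \<le> ennreal (1 / sqrt (1 - \<tau>))"
    using \<tau> by (intro ennreal_leI divide_left_mono) auto
  finally have "measure (X \<bind> ?Q) A \<le> sqrt ((1 + \<delta>) * exp (- \<delta>)) ^ N + sqrt (measure ?P A * (1 / sqrt (1 - \<tau>)))"
    using \<tau> by (intro measure_bind_gaussian_columns_le \<beta> \<delta> X.prob_space_axioms X A) auto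
  then show ?thesis by (simp add: PA QA)
qed

section \<open>Choice of constants and passage to the limit\<close>

theorem corollary5p9:
  fixes X :: "nat \<Rightarrow> (nat \<Rightarrow> real) measure"
    and N :: "nat \<Rightarrow> nat"
    and \<sigma> \<beta> \<gamma> :: real
  assumes "spike_prior X"
    and "\<sigma> > 0"
    and "\<And>n. n > 0 \<Longrightarrow>
           subgaussian (X n \<Otimes>\<^sub>M X n) (\<sigma>\<^sup>2 / real n) (\<lambda>(x, x'). \<Sum>i<n. x i * x' i)"
    and "\<beta> > 0"
    and "\<gamma> > \<beta>\<^sup>2 * \<sigma>\<^sup>2"
    and "(\<lambda>n. real n / real (N n)) \<longlonglongrightarrow> \<gamma>"
  shows "contiguous (\<lambda>n. spiked_wishart n (N n) \<beta> (X n)) (\<lambda>n. wishart n (N n))"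
  unfolding contiguous_def
proof (intro conjI allI impI)
  show "sets (spiked_wishart n (N n) \<beta> (X n)) = sets (wishart n (N n))" for n
    by (simp add: spiked_wishart_def wishart_def)
  fix B
  assume B: "\<forall>n. B n \<in> sets (wishart n (N n))"
    and lim: "(\<lambda>n. measure (wishart n (N n)) (B n)) \<longlonglongrightarrow> 0"
  \<comment> \<open>\<open>q\<close> is the limit of
    \<open>N * \<beta>\<^sup>2 * \<sigma>\<^sup>2 / n\<close>, and \<open>q < 1\<close> is the
    assumed bound on \<open>\<gamma>\<close>. The slack pays for \<open>\<delta>\<close>, chosen so
    that \<open>(1 + \<delta>) * q\<close> is midway between \<open>q\<close> and 1.\<close>
  define q where "q = \<beta>\<^sup>2 * \<sigma>\<^sup>2 / \<gamma>"
  have bs: "0 < \<beta>\<^sup>2 * \<sigma>\<^sup>2" using assms(2,4) by simp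
  then have \<gamma>: "0 < \<gamma>" using assms(5) by linarith
  have q: "0 < q" "q < 1" using bs \<gamma> assms(5) by (auto simp: q_def)
  define \<delta> where "\<delta> = (1 / q - 1) / 2"
  have \<delta>: "0 < \<delta>" using q by (simp add: \<delta>_def)
  have \<delta>q: "(1 + \<delta>) * q = (1 + q) / 2" using q by (simp add: \<delta>_def field_simps)
  \<comment> \<open>The midpoint of \<open>(1 + q) / 2\<close> and 1: the strict gap below lets the
    convergent sequence stay under \<open>\<tau>\<close> eventually, the gap above keeps
    \<open>1 / sqrt (1 - \<tau>)\<close> finite.\<close>
  define \<tau> where "\<tau> = (3 + q) / 4"
  have \<tau>: "(1 + \<delta>) * q < \<tau>" "\<tau> < 1" using q by (auto simp: \<delta>q \<tau>_def)
  define \<rho> where "\<rho> = sqrt ((1 + \<delta>) * exp (- \<delta>))"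
  have "1 + \<delta> < exp \<delta>" using \<delta> exp_minus_greater[of "- \<delta>"] by simp
  then have "(1 + \<delta>) * exp (- \<delta>) < 1" by (simp add: exp_minus field_simps)
  then have \<rho>: "0 \<le> \<rho>" "\<rho> < 1" using \<delta> by (auto simp: \<rho>_def)

  have "(\<lambda>n. (1 + \<delta>) * \<beta>\<^sup>2 * \<sigma>\<^sup>2 * inverse (real n / real (N n))) \<longlonglongrightarrow> (1 + \<delta>) * \<beta>\<^sup>2 * \<sigma>\<^sup>2 * inverse \<gamma>"
    using assms(6) \<gamma> by (intro tendsto_intros) auto
  then have "(\<lambda>n. real (N n) * (1 + \<delta>) * \<beta>\<^sup>2 * (\<sigma>\<^sup>2 / real n)) \<longlonglongrightarrow> (1 + \<delta>) * q"
    by (simp add: q_def field_simps)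
  then have ev: "eventually (\<lambda>n. real (N n) * (1 + \<delta>) * \<beta>\<^sup>2 * (\<sigma>\<^sup>2 / real n) < \<tau>) sequentially"
    using \<tau>(1) by (rule order_tendstoD)
  have "eventually (\<lambda>n. real n / real (N n) < 2 * \<gamma>) sequentially"
    "eventually (\<lambda>n. 0 < real n / real (N n)) sequentially"
    using assms(6) \<gamma> by (auto intro: order_tendstoD)
  then have "eventually (\<lambda>n. 1 / (2 * \<gamma>) * real n \<le> real (N n)) sequentially"
  proof eventually_elim
    case (elim n)
    \<comment> \<open>Division by 0 yields 0, so positivity of the ratio excludes
      \<open>N n = 0\<close>.\<close>
    then have "0 < N n" by (cases "N n = 0") auto
    with elim \<gamma> show ?case by (simp add: field_simps)
  qed
  moreover have "filterlim (\<lambda>n. 1 / (2 * \<gamma>) * real n) at_top sequentially"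
    using \<gamma> by (intro filterlim_tendsto_pos_mult_at_top[OF tendsto_const _ filterlim_real_sequentially]) auto
  ultimately have "filterlim (\<lambda>n. real (N n)) at_top sequentially"
    by (rule filterlim_at_top_mono[rotated])
  then have N: "filterlim N at_top sequentially"
    by (simp add: filterlim_sequentially_iff_filterlim_real)

  \<comment> \<open>The second moment constant does not depend on \<open>n\<close>, so the null
    probability of \<open>B n\<close> alone drives the second term to 0, while the first vanishes
    because \<open>\<rho> < 1\<close> and \<open>N\<close> tends to infinity.\<close>
  have bound: "eventually (\<lambda>n. measure (spiked_wishart n (N n) \<beta> (X n)) (B n)
      \<le> \<rho> ^ N n + sqrt (measure (wishart n (N n)) (B n) / sqrt (1 - \<tau>))) sequentially"
    using ev eventually_gt_at_top[of 0]
  proof eventually_elim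
    case (elim n)
    show ?case
      unfolding \<rho>_def
      using assms(1,4) \<delta> assms(3)[OF elim(2)] elim(1) \<tau>(2) B
      by (intro measure_spiked_wishart_le) (auto simp: spike_prior_def)
  qed
  have "(\<lambda>n. \<rho> ^ n) \<longlonglongrightarrow> 0" using \<rho> by (intro LIMSEQ_power_zero) auto
  then have "(\<lambda>n. \<rho> ^ N n) \<longlonglongrightarrow> 0"
    using N by (rule filterlim_compose)
  moreover have "(\<lambda>n. sqrt (measure (wishart n (N n)) (B n) / sqrt (1 - \<tau>))) \<longlonglongrightarrow> sqrt (0 / sqrt (1 - \<tau>))"
    using lim \<tau>(2) by (intro tendsto_intros) auto
  ultimately have "(\<lambda>n. \<rho> ^ N n + sqrt (measure (wishart n (N n)) (B n) / sqrt (1 - \<tau>))) \<longlonglongrightarrow> 0 + sqrt (0 / sqrt (1 - \<tau>))"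
    by (rule tendsto_add)
  then have "(\<lambda>n. \<rho> ^ N n + sqrt (measure (wishart n (N n)) (B n) / sqrt (1 - \<tau>))) \<longlonglongrightarrow> 0"
    by simp
  from tendsto_sandwich[OF _ bound tendsto_const this]
  show "(\<lambda>n. measure (spiked_wishart n (N n) \<beta> (X n)) (B n)) \<longlonglongrightarrow> 0"
    by simp
qed

end
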